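(* For all integers $g\geq 1$ and $\ell\geq 1$, the pair $(g\mathrm{exc}_\ell, g\mathrm{den}_{g+\ell})$ is $r$-Euler-Mahonian with $r=g+\ell-1$; that is, for every $n\geq 1$, $$\sum_{\pi\in\mathfrak{S}_n} t^{g\mathrm{exc}_\ell(\pi)}q^{g\mathrm{den}_{g+\ell}(\pi)}=\sum_{\pi\in\mathfrak{S}_n} t^{r\mathrm{des}(\pi)}q^{r\mathrm{maj}(\pi)},\qquad r=g+\ell-1.$$
   Context: Let $[n]=\{1,\dots,n\}$ and let $\mathfrak{S}_n$ be the set of permutations $\pi=\pi_1\pi_2\cdots\pi_n$ of $[n]$ in one-line notation. For a word $w=w_1\cdots w_k$ of distinct integers, $\mathrm{inv}(w)$ is the number of pairs $i<j$ with $w_i>w_j$. For $r\geq 1$ and $\pi\in\mathfrak{S}_n$, let $r\mathrm{Des}(\pi)=\{i\in[n-1]\mid \pi_i\geq \pi_{i+1}+r\}$ and $r\mathrm{Inv}(\pi)=\{(i,j)\mid i<j,\ \pi_i>\pi_j,\ \pi_i<\pi_j+r\}$. Set $r\mathrm{des}(\pi)=|r\mathrm{Des}(\pi)|$ and $r\mathrm{maj}(\pi)=\sum_{i\in r\mathrm{Des}(\pi)} i+|r\mathrm{Inv}(\pi)|$. For $g,m\geq 1$ and $\pi\in\mathfrak{S}_n$, an index $i\in[n-1]$ is a $g$-gap $m$-level excedance place if $\pi_i\geq i+g$ and $\pi_i\geq m$. Let $g\mathrm{Excp}_m(\pi)$ be the set of these places and $g\mathrm{Nexcp}_m(\pi)=[n]\setminus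 g\mathrm{Excp}_m(\pi)$. Let $g\mathrm{Exc}_m(\pi)$ (resp. $g\mathrm{Nexc}_m(\pi)$) be the subword of $\pi$ formed by the letters $\pi_i$ with $i\in g\mathrm{Excp}_m(\pi)$ (resp. $i\in g\mathrm{Nexcp}_m(\pi)$), in increasing order of $i$. Define $$g\mathrm{den}_m(\pi)=\sum_{i\in g\mathrm{Excp}_m(\pi)}(i+g-1)+\mathrm{inv}(g\mathrm{Exc}_m(\pi))+\mathrm{inv}(g\mathrm{Nexc}_m(\pi)),$$ $$g\mathrm{exc}_m(\pi)=|\{i\mid \pi_i\geq i+g,\ i\geq m\}|.$$ (In the claim $g\mathrm{exc}$ is taken at level $m=\ell$ and $g\mathrm{den}$ at level $m=g+\ell$.) *)

theory Defs
  imports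
    "HOL-Combinatorics.Permutations"
    "HOL-Computational_Algebra.Polynomial"
begin

text \<open>A permutation of \<open>{1..n}\<close> is a function \<open>p\<close> with \<open>p permutes {1..n}\<close>; the letter
  \<open>\<pi>\<^sub>i\<close> of its one-line notation is \<open>p i\<close>. The length \<open>n\<close> is passed to every statistic,
  since it cannot be read off from \<open>p\<close>.\<close>

definition word_inv :: "'a::linorder list \<Rightarrow> nat" where
  "word_inv w = card {(i, j). i < j \<and> j < length w \<and> w ! i > w ! j}"

definition subword_at :: "(nat \<Rightarrow> nat) \<Rightarrow> nat set \<Rightarrow> nat list" where
  "subword_at p A = map p (sorted_list_of_set A)"

definition rDes :: "nat \<Rightarrow> nat \<Rightarrow> (nat \<Rightarrow> nat) \<Rightarrow> nat set" where
  "rDes r n p = {i \<in> {1..n-1}. p i \<ge> p (i + 1) + r}"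

definition rInv :: "nat \<Rightarrow> nat \<Rightarrow> (nat \<Rightarrow> nat) \<Rightarrow> (nat \<times> nat) set" where
  "rInv r n p = {(i, j). i \<in> {1..n} \<and> j \<in> {1..n} \<and> i < j \<and> p i > p j \<and> p i < p j + r}"

definition rdes :: "nat \<Rightarrow> nat \<Rightarrow> (nat \<Rightarrow> nat) \<Rightarrow> nat" where
  "rdes r n p = card (rDes r n p)"

definition rmaj :: "nat \<Rightarrow> nat \<Rightarrow> (nat \<Rightarrow> nat) \<Rightarrow> nat" where
  "rmaj r n p = (\<Sum>i\<in>rDes r n p. i) + card (rInv r n p)"

definition gExcp :: "nat \<Rightarrow> nat \<Rightarrow> nat \<Rightarrow> (nat \<Rightarrow> nat) \<Rightarrow> nat set" where
  "gExcp g m n p = {i \<in> {1..n-1}. p i \<ge> i + g \<and> p i \<ge> m}"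

definition gNexcp :: "nat \<Rightarrow> nat \<Rightarrow> nat \<Rightarrow> (nat \<Rightarrow> nat) \<Rightarrow> nat set" where
  "gNexcp g m n p = {1..n} - gExcp g m n p"

definition gExc :: "nat \<Rightarrow> nat \<Rightarrow> nat \<Rightarrow> (nat \<Rightarrow> nat) \<Rightarrow> nat list" where
  "gExc g m n p = subword_at p (gExcp g m n p)"

definition gNexc :: "nat \<Rightarrow> nat \<Rightarrow> nat \<Rightarrow> (nat \<Rightarrow> nat) \<Rightarrow> nat list" where
  "gNexc g m n p = subword_at p (gNexcp g m n p)"

definition gden :: "nat \<Rightarrow> nat \<Rightarrow> nat \<Rightarrow> (nat \<Rightarrow> nat) \<Rightarrow> nat" where
  "gden g m n p =
     (\<Sum>i\<in>gExcp g m n p. i + g - 1) + word_inv (gExc g m n p) + word_inv (gNexc g m n p)"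

text \<open>Unlike in \<^const>\<open>gExcp\<close>, the level bounds the place \<open>i\<close> here, not the letter \<open>p i\<close>;
  \<open>gexc g m n p\<close> is thus in general not the cardinality of \<open>gExcp g m n p\<close>.\<close>

definition gexc :: "nat \<Rightarrow> nat \<Rightarrow> nat \<Rightarrow> (nat \<Rightarrow> nat) \<Rightarrow> nat" where
  "gexc g m n p = card {i \<in> {1..n}. p i \<ge> i + g \<and> i \<ge> m}"

text \<open>The indeterminates \<open>t\<close> and \<open>q\<close> of the polynomial ring \<open>\<int>[q][t]\<close>.\<close>

definition var_t :: "int poly poly" where
  "var_t = [:0, 1:]"

definition var_q :: "int poly poly" where
  "var_q = [:[:0, 1:]:]"

definition r_Euler_Mahonian ::
  "nat \<Rightarrow> (nat \<Rightarrow> (nat \<Rightarrow> nat) \<Rightarrow> nat) \<Rightarrow> (nat \<Rightarrow> (nat \<Rightarrow> nat) \<Rightarrow> nat) \<Rightarrow> bool" where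
  "r_Euler_Mahonian r stat1 stat2 \<longleftrightarrow>
     (\<forall>n\<ge>1. (\<Sum>p | p permutes {1..n}. var_t ^ stat1 n p * var_q ^ stat2 n p) =
            (\<Sum>p | p permutes {1..n}. var_t ^ rdes r n p * var_q ^ rmaj r n p))"

end

theory Submission
  imports Defs Complex_Main
begin

text \<open>
  Put \<open>r = g + l - 1\<close>. Inserting \<open>n + 1\<close> into a permutation of \<open>{1..n}\<close> with \<open>k\<close> \<open>r\<close>-descents, where
  \<open>n \<ge> r\<close>, multiplies its weight by \<open>[r + k] + t q\<^sup>r\<^sup>+\<^sup>k [n + 1 - r - k]\<close>; this is a \<open>q\<close>-difference
  recursion in \<open>t\<close> for the generating polynomial of \<open>(rdes, rmaj)\<close>.

  For \<open>(gexc, gden)\<close>, scan the places \<open>i\<close> and the values \<open>v\<close> in such an order that \<open>i\<close> precedes \<open>v\<close> iff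
  \<open>v \<ge> max i l + g\<close>. An excedance place is opened when met and later closed by a value, any
  other place takes an unused value at once, and both kinds of inversions are counted by \<open>q\<close>-integers
  at each choice. Hence the sum is a weighted count of paths for the number \<open>h\<close> of open places. The
  places \<open>i < l\<close> act by operators that intertwine the path recursion with parameter \<open>d\<close> and that
  with \<open>d + 1\<close>, which reduces to \<open>g = r\<close>, \<open>l = 1\<close>. There the path weights ending at height
  \<open>h\<close> are iterated \<open>q\<close>-differences of the generating polynomial of \<open>(rdes, rmaj)\<close>, and at
  \<open>h = 0\<close> they are that polynomial itself.
\<close>

subsection \<open>Path recursions and q-differences\<close>

definition q_num :: "real \<Rightarrow> nat \<Rightarrow> real" where
  "q_num q n = (\<Sum>i<n. q ^ i)"

lemma q_num_0 [simp]: "q_num q 0 = 0"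
  by (simp add: q_num_def)

lemma q_num_Suc: "q_num q (Suc n) = q_num q n + q ^ n"
  by (simp add: q_num_def)

lemma q_num_Suc': "q_num q (Suc n) = 1 + q * q_num q n"
proof (induction n)
  case (Suc n)
  have "q_num q (Suc (Suc n)) = (1 + q * q_num q n) + q * q ^ n"
    by (simp only: q_num_Suc[of q "Suc n"] Suc power_Suc)
  also have "\<dots> = 1 + q * q_num q (Suc n)"
    by (simp only: q_num_Suc[of q n] algebra_simps)
  finally show ?case .
qed (simp add: q_num_Suc)

lemma one_minus_q_num: "(1 - q) * q_num q n = 1 - q ^ n"
  by (simp add: q_num_def one_diff_power_eq)

lemma q_num_pos: "q > 0 \<Longrightarrow> q_num q (Suc n) > 0"
  unfolding q_num_def by (rule sum_pos) auto

definition q_fact :: "real \<Rightarrow> nat \<Rightarrow> real" where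
  "q_fact q n = (\<Prod>i=1..n. q_num q i)"

lemma q_fact_0 [simp]: "q_fact q 0 = 1"
  by (simp add: q_fact_def)

lemma q_fact_Suc: "q_fact q (Suc n) = q_num q (Suc n) * q_fact q n"
  by (simp add: q_fact_def)

lemma q_fact_pos: "q > 0 \<Longrightarrow> q_fact q n > 0"
  by (induction n) (simp_all add: q_fact_Suc q_num_pos)

text \<open>If \<open>f\<close> is the polynomial in \<open>t\<close> obtained after \<open>N\<close> steps of the Rawlings recursion, then, up
  to scaling, \<open>q_diff q N f h\<close> is the weight of the paths of \<open>N\<close> steps that end at height \<open>h\<close>.\<close>

primrec q_diff :: "real \<Rightarrow> nat \<Rightarrow> (real \<Rightarrow> real) \<Rightarrow> nat \<Rightarrow> real \<Rightarrow> real" where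
  "q_diff q N f 0 t = f t"
| "q_diff q N f (Suc h) t =
     ((1 - t * q ^ N / q ^ h) * q_diff q N f h t
       - (1 - t) / q ^ h * q_diff q N f h (q * t)) / (1 - q)"

text \<open>For \<open>N = 0\<close> the first difference of a constant cancels, and zero stays
  zero. So the recursion starts at height 0 only.\<close>

lemma q_diff_const:
  assumes "q \<noteq> 1"
  shows "q_diff q 0 (\<lambda>_. c) (Suc h) t = 0"
  by (induction h arbitrary: t) auto

text \<open>The defining equation solved for the value at \<open>q * t\<close>, used to eliminate
  shifted arguments.\<close>

lemma q_diff_shift:
  assumes "q > 0" "q \<noteq> 1"
  shows "(1 - t) * q_diff q N f h (q * t) =
         (q ^ h - t * q ^ N) * q_diff q N f h t - q ^ h * (1 - q) * q_diff q N f (Suc h) t"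
  using assms by (simp add: field_simps)

text \<open>Induction on \<open>h\<close>: take the difference of the identity for \<open>h\<close>
  at \<open>t\<close> and at \<open>q * t\<close>, and eliminate the values at \<open>q * t\<close>
  by \<open>q_diff_shift\<close>. The terms at height \<open>h - 1\<close> cancel, so three heights
  remain.\<close>

lemma q_diff_step:
  assumes q: "q > 0" "q \<noteq> 1"
    and f': "\<And>t. (1 - q) * f' t = (1 - t * q ^ (N + r + 1)) * f t - q ^ r * (1 - t) * f (q * t)"
  shows "q_diff q (Suc N) f' h t =
     q ^ (r + h) * q_diff q N f (Suc h) t
     + (q_num q (r + h) + t * q ^ (N + r) * q_num q (Suc h)) * q_diff q N f h t
     + t * q ^ N * q / q ^ h * q_num q h * q_num q (r + h) * q_diff q N f (h - 1) t"
proof (induction h arbitrary: t)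
  case 0
  have "(1 - q) * f' t = (1 - q) * (q ^ r * q_diff q N f (Suc 0) t
     + (q_num q r + t * q ^ (N + r)) * f t)"
  proof -
    have "(1 - q) * (q ^ r * q_diff q N f (Suc 0) t + (q_num q r + t * q ^ (N + r)) * f t)
      = q ^ r * ((1 - q) * q_diff q N f (Suc 0) t)
        + ((1 - q) * q_num q r + (1 - q) * t * q ^ (N + r)) * f t"
      by (simp only: distrib_left distrib_right mult.assoc mult.left_commute)
    also have "(1 - q) * q_diff q N f (Suc 0) t = (1 - t * q ^ N) * f t - (1 - t) * f (q * t)"
      using q by simp
    finally show ?thesis
      unfolding f' one_minus_q_num by (simp add: power_add algebra_simps del: q_diff.simps)
  qed
  then show ?case
    using q by (simp add: q_num_Suc del: q_diff.simps(2))
next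
  case (Suc h)
  define X where "X j = q_diff q N f j t" for j
  define Y where "Y j = (1 - t) * q_diff q N f j (q * t)" for j
  define Q where "Q = q ^ h"
  define A where "A = q ^ N"
  define \<rho> where "\<rho> = q ^ r"
  define u where "u = q_num q h"
  define v where "v = q_num q (r + h)"
  have Q: "Q > 0" using q by (simp add: Q_def)
  have Y: "Y j = (q ^ j - t * A) * X j - q ^ j * (1 - q) * X (Suc j)" for j
    unfolding Y_def X_def A_def by (rule q_diff_shift[OF q])
  have Y0: "Y h = (Q - t * A) * X h - Q * (1 - q) * X (Suc h)"
    using Y[of h] by (simp add: Q_def)
  have Y1: "Y (Suc h) = (q * Q - t * A) * X (Suc h) - q * Q * (1 - q) * X (Suc (Suc h))"
    using Y[of "Suc h"] by (simp add: Q_def)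
  \<comment> \<open>The truncated \<open>h - 1\<close> is harmless at \<open>h = 0\<close>, where
    \<open>u = 0\<close>.\<close>
  have Ym: "u * (q * Y (h - 1)) = u * ((Q - t * A * q) * X (h - 1) - Q * (1 - q) * X h)"
  proof (cases h)
    case (Suc j)
    then have "Q = q * q ^ j" by (simp add: Q_def)
    then show ?thesis unfolding Suc diff_Suc_1 Y[of j] by (simp add: algebra_simps)
  qed (simp add: u_def)
  have uh: "q_num q (Suc h) = 1 + q * u" "q_num q (Suc (Suc h)) = 1 + q * (1 + q * u)"
    by (simp_all add: u_def q_num_Suc')
  have vh: "q_num q (Suc (r + h)) = v + \<rho> * Q"
    by (simp add: v_def q_num_Suc \<rho>_def Q_def power_add)
  have IH: "q_diff q (Suc N) f' h t = \<rho> * Q * X (Suc h) + (v + t * (A * \<rho>) * (1 + q * u)) * X h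
     + t * A * q / Q * u * v * X (h - 1)"
    unfolding Suc.IH[of t] X_def Q_def A_def \<rho>_def u_def v_def q_num_Suc'[of q h] power_add
    by (simp del: q_diff.simps)
  have IH': "(1 - t) * q_diff q (Suc N) f' h (q * t) =
     \<rho> * Q * Y (Suc h) + (v + q * t * (A * \<rho>) * (1 + q * u)) * Y h
     + q * t * A * q / Q * u * v * Y (h - 1)"
    unfolding Suc.IH[of "q * t"] Y_def Q_def A_def \<rho>_def u_def v_def q_num_Suc'[of q h] power_add
    by (simp add: algebra_simps diff_divide_distrib del: q_diff.simps)
  have "q_diff q (Suc N) f' (Suc h) t =
     ((Q - t * A * q) * q_diff q (Suc N) f' h t - (1 - t) * q_diff q (Suc N) f' h (q * t)) / (Q * (1 - q))"
    using q Q by (simp add: Q_def A_def field_simps)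
  also have "\<dots> = \<rho> * (q * Q) * X (Suc (Suc h))
     + ((v + \<rho> * Q) + t * (A * \<rho>) * (1 + q * (1 + q * u))) * X (Suc h)
     + t * A / Q * (1 + q * u) * (v + \<rho> * Q) * X h" (is "?L = ?R")
  proof -
    have e: "q * t * A * q / Q * u * v * Y (h - 1) = q * t * A / Q * v * (u * (q * Y (h - 1)))"
      by simp
    have "(Q - t * A * q) * q_diff q (Suc N) f' h t - (1 - t) * q_diff q (Suc N) f' h (q * t)
        = (Q * (1 - q)) * ?R"
      unfolding IH IH' e Ym Y0 Y1 using Q by (simp add: field_simps)
    then show ?thesis using q Q by simp
  qed
  also have "\<dots> = q ^ (r + Suc h) * q_diff q N f (Suc (Suc h)) t
     + (q_num q (r + Suc h) + t * q ^ (N + r) * q_num q (Suc (Suc h))) * q_diff q N f (Suc h) t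
     + t * q ^ N * q / q ^ Suc h * q_num q (Suc h) * q_num q (r + Suc h) * q_diff q N f (Suc h - 1) t"
    using q unfolding add_Suc_right uh vh
    by (simp add: X_def Q_def A_def \<rho>_def power_add del: q_diff.simps)
  finally show ?case .
qed

text \<open>\<open>q_path q d w s h\<close> is the weight of the last \<open>s\<close> double steps (a place, then a value) of the
  scan from a state with \<open>h\<close> open places and \<open>d + h\<close> unused values.\<close>

primrec q_path :: "real \<Rightarrow> nat \<Rightarrow> (nat \<Rightarrow> real) \<Rightarrow> nat \<Rightarrow> nat \<Rightarrow> real" where
  "q_path q d w 0 h = (if h = 0 then q_fact q d else 0)"
| "q_path q d w (Suc s) h =
     q_num q (d + h) * (q_num q h * q_path q d w s (h - 1) + q_path q d w s h)
     + w s * (q_num q (Suc h) * q_path q d w s h + q_path q d w s (Suc h))"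

definition q_raise :: "real \<Rightarrow> nat \<Rightarrow> real \<Rightarrow> (nat \<Rightarrow> real) \<Rightarrow> nat \<Rightarrow> real" where
  "q_raise q d w y h = q_num q (d + h) * y h + w * y (Suc h)"

text \<open>In both compositions the coefficient of \<open>y (Suc h)\<close> is
  \<open>w + w'\<close> times the same q-integer.\<close>

lemma q_raise_swap:
  "q_raise q (Suc d) w (q_raise q d w' y) = q_raise q (Suc d) w' (q_raise q d w y)"
  by (rule ext) (simp add: q_raise_def algebra_simps)

text \<open>\<open>q_num q (d + h + 1)\<close> exceeds \<open>q_num q (d + h)\<close> by
  \<open>q ^ d * q ^ h\<close>; the weight \<open>q ^ d\<close> is matched to this, and the operator
  intertwines the two path recursions.\<close>

lemma q_raise_path:
  "q_raise q (Suc d) (q ^ d) (q_path q d w s) = q_path q (Suc d) w s"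
proof (induction s)
  case 0
  show ?case by (rule ext) (simp add: q_raise_def q_fact_Suc)
next
  case (Suc s)
  define y where "y = q_path q d w s"
  have IH: "q_path q (Suc d) w s = q_raise q (Suc d) (q ^ d) y"
    by (simp add: Suc y_def)
  show ?case
  proof
    fix h
    have e: "q_num q (Suc (d + h)) = q_num q (d + h) + q ^ d * q ^ h" "q_num q (Suc h) = q_num q h + q ^ h"
      by (simp_all add: q_num_Suc power_add)
    have e2: "q_num q (Suc (Suc h)) = q_num q h + q ^ h + q * q ^ h"
      by (simp add: q_num_Suc)
    have e3: "q_num q (Suc (Suc (d + h))) = q_num q (d + h) + q ^ d * q ^ h + q * q ^ d * q ^ h"
      by (simp add: q_num_Suc power_add)
    show "q_raise q (Suc d) (q ^ d) (q_path q d w (Suc s)) h = q_path q (Suc d) w (Suc s) h"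
    proof (cases h)
      case 0
      then show ?thesis
        using e e2 e3 by (simp add: IH q_raise_def y_def[symmetric] algebra_simps)
    next
      case (Suc j)
      then have "q_num q (Suc (d + (h - 1))) = q_num q (d + h)" "Suc (h - 1) = h" by simp_all
      then show ?thesis
        by (simp add: IH q_raise_def y_def[symmetric] e e2 e3) (simp add: algebra_simps)
    qed
  qed
qed

lemma q_path_eq_0: "h > s \<Longrightarrow> q_path q d w s h = 0"
  by (induction s arbitrary: h) auto

text \<open>The recursion for \<open>c\<close> is the transpose of the recursion of \<^const>\<open>q_path\<close>, which runs
  backwards; so the pairing of the two does not depend on where the path is cut.\<close>

lemma q_path_pairing:
  fixes c :: "nat \<Rightarrow> nat \<Rightarrow> real"
  assumes c: "\<And>j h. c (Suc j) h = (q_num q (d + h) + w' j * q_num q (Suc h)) * c j h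
                 + (if h = 0 then 0 else w' j * c j (h - 1))
                 + q_num q (Suc h) * q_num q (Suc (d + h)) * c j (Suc h)"
    and w: "\<And>j. j < m \<Longrightarrow> w' j = w (m - Suc j)"
    and K: "m < K"
  shows "j \<le> m \<Longrightarrow> (\<Sum>h\<le>K. c j h * q_path q d w (m - j) h) = (\<Sum>h\<le>K. c 0 h * q_path q d w m h)"
proof (induction j)
  case (Suc j)
  define y where "y = q_path q d w (m - Suc j)"
  have mj: "m - j = Suc (m - Suc j)" using Suc.prems by simp
  \<comment> \<open>Since \<open>K > m\<close>, the two reindexings below lose no term at the upper
    end.\<close>
  have y0: "y (Suc K) = 0" "y K = 0"
    using K by (simp_all add: y_def q_path_eq_0)
  obtain K' where K': "K = Suc K'" using K by (cases K) auto
  have "(\<Sum>h\<le>K. c j h * q_path q d w (m - j) h) =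
      (\<Sum>h\<le>K. c j h * q_num q (d + h) * q_num q h * y (h - 1))
      + (\<Sum>h\<le>K. (q_num q (d + h) + w' j * q_num q (Suc h)) * c j h * y h)
      + (\<Sum>h\<le>K. w' j * c j h * y (Suc h))"
    unfolding mj using w[of j] Suc.prems
    by (simp add: y_def[symmetric] sum.distrib[symmetric] algebra_simps)
  also have "(\<Sum>h\<le>K. c j h * q_num q (d + h) * q_num q h * y (h - 1))
      = (\<Sum>h\<le>K. q_num q (Suc h) * q_num q (Suc (d + h)) * c j (Suc h) * y h)"
  proof -
    have "(\<Sum>h\<le>K. c j h * q_num q (d + h) * q_num q h * y (h - 1))
      = (\<Sum>h\<le>K'. c j (Suc h) * q_num q (d + Suc h) * q_num q (Suc h) * y h)"
      unfolding K' sum.atMost_Suc_shift by simp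
    then show ?thesis using y0 by (simp add: K' mult_ac)
  qed
  also have "(\<Sum>h\<le>K. w' j * c j h * y (Suc h)) = (\<Sum>h\<le>K. (if h = 0 then 0 else w' j * c j (h - 1)) * y h)"
    unfolding K' sum.atMost_Suc_shift[of "\<lambda>h. _ h * y h" K'] sum.atMost_Suc[of _ K'] using y0 K' by simp
  finally have "(\<Sum>h\<le>K. c j h * q_path q d w (m - j) h) = (\<Sum>h\<le>K. c (Suc j) h * y h)"
    unfolding c by (simp add: sum.distrib[symmetric] algebra_simps)
  with Suc show ?case by (simp add: y_def)
qed simp

text \<open>The scaling that turns the identity \<open>q_diff_step\<close> into the recursion for \<open>c\<close> in
  \<open>q_path_pairing\<close>.\<close>

primrec q_weight :: "real \<Rightarrow> nat \<Rightarrow> nat \<Rightarrow> real" where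
  "q_weight q r 0 = 1"
| "q_weight q r (Suc h) =
     q_weight q r h * q ^ (r + h) / (q_num q (Suc h) * q_num q (Suc (r + h)))"

text \<open>Cutting the pairing at its two ends leaves one term each: with no steps left the path
  weight vanishes off height 0, and with none done so do the differences of the constant
  \<open>f 0\<close>. Path weights are indexed by the steps still to come, hence the reversed index
  of \<open>w\<close>.\<close>

lemma q_path_eq_of_recursion:
  assumes q: "q > 0" "q \<noteq> 1"
    and f0: "\<And>t. f 0 t = a"
    and f: "\<And>N t. (1 - q) * f (Suc N) t =
              (1 - t * q ^ (N + r + 1)) * f N t - q ^ r * (1 - t) * f N (q * t)"
    and w: "\<And>j. j < m \<Longrightarrow> w (m - Suc j) = t * q ^ (r + j)"
  shows "a * q_path q r w m 0 = q_fact q r * f m t"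
proof -
  define c where "c N h = q_weight q r h * q_diff q N (f N) h t" for N h
  have pos: "q_num q (Suc h) \<noteq> 0" for h
    using q_num_pos[OF q(1), of h] by simp
  have "c (Suc j) h = (q_num q (r + h) + t * q ^ (r + j) * q_num q (Suc h)) * c j h
           + (if h = 0 then 0 else t * q ^ (r + j) * c j (h - 1))
           + q_num q (Suc h) * q_num q (Suc (r + h)) * c j (Suc h)" for j h
  proof -
    have X: "q_diff q (Suc j) (f (Suc j)) h t =
       q ^ (r + h) * q_diff q j (f j) (Suc h) t
       + (q_num q (r + h) + t * q ^ (j + r) * q_num q (Suc h)) * q_diff q j (f j) h t
       + t * q ^ j * q / q ^ h * q_num q h * q_num q (r + h) * q_diff q j (f j) (h - 1) t"
      by (rule q_diff_step[OF q]) (use f in simp)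
    have 1: "q_weight q r h * (q ^ (r + h) * q_diff q j (f j) (Suc h) t)
        = q_num q (Suc h) * q_num q (Suc (r + h)) * c j (Suc h)"
      using pos[of h] pos[of "r + h"] by (simp add: c_def)
    have 2: "q_weight q r h * (t * q ^ j * q / q ^ h * q_num q h * q_num q (r + h) * q_diff q j (f j) (h - 1) t)
        = (if h = 0 then 0 else t * q ^ (r + j) * c j (h - 1))"
    proof (cases h)
      case (Suc k)
      then show ?thesis
        using q pos[of k] pos[of "r + k"] by (simp add: c_def power_add)
    qed simp
    show ?thesis
      unfolding c_def[of "Suc j"] X distrib_left 1 2
      by (simp add: c_def add.commute)
  qed
  from q_path_pairing[of c q r "\<lambda>j. t * q ^ (r + j)" m w "Suc m" m, OF this]
  have "(\<Sum>h\<le>Suc m. c m h * q_path q r w 0 h) = (\<Sum>h\<le>Suc m. c 0 h * q_path q r w m h)"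
    using w by simp
  moreover have "c m h * q_path q r w 0 h = (if h = 0 then q_fact q r * f m t else 0)" for h
    by (simp add: c_def)
  moreover have "c 0 h * q_path q r w m h = (if h = 0 then a * q_path q r w m 0 else 0)" for h
  proof (cases h)
    case (Suc k)
    have "f 0 = (\<lambda>_. a)" using f0 by auto
    then show ?thesis using q_diff_const[of q a k t] q Suc by (simp add: c_def del: q_diff.simps)
  qed (simp add: c_def f0)
  ultimately show ?thesis by (simp del: sum.atMost_Suc)
qed

subsection \<open>Scanning a permutation by places and values\<close>

definition inv_on :: "(nat \<Rightarrow> nat) \<Rightarrow> nat set \<Rightarrow> nat" where
  "inv_on f A = card {(i, j). i \<in> A \<and> j \<in> A \<and> i < j \<and> f j < f i}"

lemma inv_on_cong: "(\<And>i. i \<in> A \<Longrightarrow> f i = f' i) \<Longrightarrow> inv_on f A = inv_on f' A"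
  unfolding inv_on_def by (rule arg_cong[where f = card]) auto

lemma inv_on_insert:
  assumes "finite A" "i \<notin> A"
  shows "inv_on f (insert i A) =
    inv_on f A + card {j \<in> A. i < j \<and> f j < f i} + card {j \<in> A. j < i \<and> f i < f j}"
proof -
  define P where "P = {(i, j). i \<in> A \<and> j \<in> A \<and> i < j \<and> f j < f i}"
  define Q where "Q = Pair i ` {j \<in> A. i < j \<and> f j < f i}"
  define R where "R = (\<lambda>j. (j, i)) ` {j \<in> A. j < i \<and> f i < f j}"
  have "{(k, j). k \<in> insert i A \<and> j \<in> insert i A \<and> k < j \<and> f j < f k} = P \<union> Q \<union> R"
    by (auto simp: P_def Q_def R_def)
  moreover have "finite P"
    by (rule finite_subset[of _ "A \<times> A"]) (auto simp: P_def assms)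
  moreover have "finite Q" "finite R" "P \<inter> Q = {}" "(P \<union> Q) \<inter> R = {}"
    using assms by (auto simp: P_def Q_def R_def)
  moreover have "card Q = card {j \<in> A. i < j \<and> f j < f i}" "card R = card {j \<in> A. j < i \<and> f i < f j}"
    unfolding Q_def R_def by (auto intro!: card_image inj_onI)
  ultimately show ?thesis
    unfolding inv_on_def by (simp add: card_Un_disjoint P_def[symmetric])
qed

text \<open>The ranks are 0, ..., \<open>card A - 1\<close>, each once. This sums every choice made
  in the scan.\<close>

lemma sum_power_rank:
  fixes A :: "nat set"
  assumes "finite A"
  shows "(\<Sum>x\<in>A. q ^ card {y \<in> A. y < x}) = q_num q (card A)"
  using assms
proof (induction A rule: finite_linorder_max_induct)
  case (insert b A)
  have "{y \<in> insert b A. y < b} = A" using insert by auto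
  moreover have "{y \<in> insert b A. y < x} = {y \<in> A. y < x}" if "x \<in> A" for x
    using insert that by auto
  moreover have "b \<notin> A" using insert by auto
  ultimately show ?case
    using insert by (simp add: q_num_Suc)
qed simp

text \<open>Being the identity off \<open>I\<close> makes a function determined by its values on
  \<open>I\<close>, and turns \<open>bijs S S\<close> into the permutations of
  \<open>S\<close>.\<close>

definition bijs :: "nat set \<Rightarrow> nat set \<Rightarrow> (nat \<Rightarrow> nat) set" where
  "bijs I J = {f. bij_betw f I J \<and> (\<forall>i. i \<notin> I \<longrightarrow> f i = i)}"

lemma bijs_permutes: "bijs S S = {p. p permutes S}"
  unfolding bijs_def by (auto intro: bij_imp_permutes permutes_imp_bij simp: permutes_not_in)

lemma finite_bijs:
  assumes "finite I" "finite J"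
  shows "finite (bijs I J)"
proof -
  have "inj_on (\<lambda>f. restrict f I) (bijs I J)"
  proof (rule inj_onI, rule ext)
    fix f g i
    assume fg: "f \<in> bijs I J" "g \<in> bijs I J" and eq: "restrict f I = restrict g I"
    from fun_cong[OF eq, of i] show "f i = g i"
      using fg by (cases "i \<in> I") (simp_all add: bijs_def)
  qed
  moreover have "(\<lambda>f. restrict f I) ` bijs I J \<subseteq> I \<rightarrow>\<^sub>E J"
    by (auto simp: bijs_def bij_betw_def)
  ultimately show ?thesis
    using assms by (meson finite_PiE finite_imageD finite_subset)
qed

text \<open>Resetting \<open>i\<close> to itself undoes the assignment of \<open>x\<close>; this
  peels one place off a state.\<close>

lemma bij_betw_bijs_update:
  assumes "i \<notin> I" "x \<notin> J"
  shows "bij_betw (\<lambda>f. f(i := x)) (bijs I J) {f \<in> bijs (insert i I) (insert x J). f i = x}"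
proof (rule bij_betwI[where g = "\<lambda>f. f(i := i)"])
  show "(\<lambda>f. f(i := x)) \<in> bijs I J \<rightarrow> {f \<in> bijs (insert i I) (insert x J). f i = x}"
  proof
    fix f assume f: "f \<in> bijs I J"
    have "bij_betw (f(i := x)) I J"
      using f assms by (subst bij_betw_cong[of _ _ f]) (auto simp: bijs_def)
    then have "bij_betw (f(i := x)) (insert i I) (insert x J)"
      using assms notIn_Un_bij_betw[of i I "f(i := x)" J] by simp
    then show "f(i := x) \<in> {f \<in> bijs (insert i I) (insert x J). f i = x}"
      using f by (auto simp: bijs_def)
  qed
  show "(\<lambda>f. f(i := i)) \<in> {f \<in> bijs (insert i I) (insert x J). f i = x} \<rightarrow> bijs I J"
  proof
    fix f assume f: "f \<in> {f \<in> bijs (insert i I) (insert x J). f i = x}"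
    then have "bij_betw f (insert i I) (insert x J)" "f i = x" by (auto simp: bijs_def)
    then have "bij_betw f I J"
      using assms notIn_Un_bij_betw3[of i I f J] by simp
    then have "bij_betw (f(i := i)) I J"
      using assms by (subst bij_betw_cong[of _ _ f]) auto
    then show "f(i := i) \<in> bijs I J" using f by (auto simp: bijs_def)
  qed
  show "(f(i := x))(i := i) = f" if "f \<in> bijs I J" for f
    using that assms by (auto simp: bijs_def)
  show "(f(i := i))(i := x) = f" if "f \<in> {f \<in> bijs (insert i I) (insert x J). f i = x}" for f
    using that by auto
qed

text \<open>A state of the scan: \<open>P\<close> are the open places (excedance places met before their letters), \<open>R\<close>
  the places still to come, \<open>A\<close> the unused values (letters of later non-excedance places), \<open>V\<close> the
  values still to come. Place \<open>i\<close> is met just before the value \<open>thr i\<close>.\<close>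

definition fillings :: "nat set \<Rightarrow> nat set \<Rightarrow> nat set \<Rightarrow> nat set \<Rightarrow> (nat \<Rightarrow> nat) set" where
  "fillings P R A V = {f \<in> bijs (P \<union> R) (A \<union> V). f ` P \<subseteq> V}"

text \<open>The product runs over \<open>R\<close> alone, as an open place contributed its
  \<open>w\<close> when it was met; the inversions of its letter are still to be counted.\<close>

definition exc_weight ::
  "real \<Rightarrow> (nat \<Rightarrow> real) \<Rightarrow> (nat \<Rightarrow> nat) \<Rightarrow> nat set \<Rightarrow> nat set \<Rightarrow> (nat \<Rightarrow> nat) \<Rightarrow> real" where
  "exc_weight q w thr P R f =
     (\<Prod>i\<in>{i \<in> R. thr i \<le> f i}. w i) *
     q ^ inv_on f (P \<union> {i \<in> R. thr i \<le> f i}) * q ^ inv_on f {i \<in> R. f i < thr i}"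

definition filling_sum ::
  "real \<Rightarrow> (nat \<Rightarrow> real) \<Rightarrow> (nat \<Rightarrow> nat) \<Rightarrow> nat set \<Rightarrow> nat set \<Rightarrow> nat set \<Rightarrow> nat set \<Rightarrow> real" where
  "filling_sum q w thr P R A V = (\<Sum>f\<in>fillings P R A V. exc_weight q w thr P R f)"

lemma finite_fillings:
  "finite P \<Longrightarrow> finite R \<Longrightarrow> finite A \<Longrightarrow> finite V \<Longrightarrow> finite (fillings P R A V)"
  by (simp add: fillings_def finite_bijs)

lemma filling_sum_no_values: "P \<noteq> {} \<Longrightarrow> filling_sum q w thr P R A {} = 0"
  by (simp add: filling_sum_def fillings_def)

lemma filling_sum_empty: "filling_sum q w thr {} {} {} {} = 1"
proof -
  have "fillings {} {} {} {} = {id}"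
    by (auto simp: fillings_def bijs_def)
  then show ?thesis
    by (simp add: filling_sum_def exc_weight_def inv_on_def)
qed

lemma filling_sum_place:
  assumes fin: "finite P" "finite R" "finite A" "finite V"
    and i: "\<And>j. j \<in> P \<Longrightarrow> j < i" "\<And>j. j \<in> R \<Longrightarrow> i < j"
    and A: "\<And>x. x \<in> A \<Longrightarrow> x < thr i" and V: "\<And>x. x \<in> V \<Longrightarrow> thr i \<le> x"
    and thr: "\<And>j. j \<in> R \<Longrightarrow> thr i \<le> thr j"
  shows "filling_sum q w thr P (insert i R) A V =
    (\<Sum>x\<in>A. q ^ card {y \<in> A. y < x} * filling_sum q w thr P R (A - {x}) V)
    + w i * filling_sum q w thr (insert i P) R A V"
proof -
  define F where "F x = {f \<in> fillings P (insert i R) A V. f i = x}" for x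
  define D where "D = fillings (insert i P) R A V"
  have i': "i \<notin> P" "i \<notin> R" using i by auto
  have AV: "A \<inter> V = {}" using A V by force
  have fin': "finite (fillings P (insert i R) A V)"
    using fin by (simp add: finite_fillings)
  have fi: "f i \<in> A \<union> V" if "f \<in> fillings P (insert i R) A V" for f
    using that by (auto simp: fillings_def bijs_def bij_betw_def)
  have D: "D = {f \<in> fillings P (insert i R) A V. f i \<in> V}"
    by (auto simp: D_def fillings_def insert_commute)
  have split: "fillings P (insert i R) A V = (\<Union>x\<in>A. F x) \<union> D"
    using fi by (auto simp: D F_def)
  have "filling_sum q w thr P (insert i R) A V =
      (\<Sum>f\<in>(\<Union>x\<in>A. F x). exc_weight q w thr P (insert i R) f)
      + (\<Sum>f\<in>D. exc_weight q w thr P (insert i R) f)"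
    unfolding filling_sum_def split
  proof (rule sum.union_disjoint)
    show "finite (\<Union>x\<in>A. F x)" "finite D"
      by (rule finite_subset[OF _ fin'], auto simp: split)+
    show "(\<Union>x\<in>A. F x) \<inter> D = {}" using AV by (auto simp: F_def D)
  qed
  also have "(\<Sum>f\<in>(\<Union>x\<in>A. F x). exc_weight q w thr P (insert i R) f) =
      (\<Sum>x\<in>A. \<Sum>f\<in>F x. exc_weight q w thr P (insert i R) f)"
  proof (rule sum.UNION_disjoint)
    show "\<forall>x\<in>A. finite (F x)" using fin' by (auto simp: F_def)
  qed (auto simp: F_def fin)
  also have "\<dots> = (\<Sum>x\<in>A. q ^ card {y \<in> A. y < x} * filling_sum q w thr P R (A - {x}) V)"
  proof (rule sum.cong[OF refl])
    fix x assume x: "x \<in> A"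
    have bij: "bij_betw (\<lambda>f. f(i := x)) (fillings P R (A - {x}) V) (F x)"
    proof -
      have "x \<notin> A - {x} \<union> V" "i \<notin> P \<union> R" using x AV i' by auto
      moreover have "insert i (P \<union> R) = P \<union> insert i R" "insert x (A - {x} \<union> V) = A \<union> V"
        using x by auto
      ultimately have b: "bij_betw (\<lambda>f. f(i := x)) (bijs (P \<union> R) (A - {x} \<union> V))
         {f \<in> bijs (P \<union> insert i R) (A \<union> V). f i = x}"
        using bij_betw_bijs_update[of i "P \<union> R" x "A - {x} \<union> V"] by simp
      have "bij_betw (\<lambda>f. f(i := x)) {f \<in> bijs (P \<union> R) (A - {x} \<union> V). f ` P \<subseteq> V}
         {f \<in> {f \<in> bijs (P \<union> insert i R) (A \<union> V). f i = x}. f ` P \<subseteq> V}"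
      proof (rule bij_betw_Collect[OF b])
        show "(f(i := x)) ` P \<subseteq> V \<longleftrightarrow> f ` P \<subseteq> V" for f
          using i' by auto
      qed
      moreover have "{f \<in> {f \<in> bijs (P \<union> insert i R) (A \<union> V). f i = x}. f ` P \<subseteq> V} = F x"
        by (auto simp: F_def fillings_def)
      ultimately show ?thesis by (simp add: fillings_def)
    qed
    have wt: "exc_weight q w thr P (insert i R) (f(i := x)) =
        q ^ card {y \<in> A. y < x} * exc_weight q w thr P R f" if f: "f \<in> fillings P R (A - {x}) V" for f
    proof -
      define E where "E = {j \<in> R. thr j \<le> f j}"
      define N where "N = {j \<in> R. f j < thr j}"
      have iE: "i \<notin> P \<union> E" "i \<notin> N" using i' by (auto simp: E_def N_def)
      have eE: "{j \<in> insert i R. thr j \<le> (f(i := x)) j} = E"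
        using A[OF x] i' by (auto simp: E_def)
      have eN: "{j \<in> insert i R. (f(i := x)) j < thr j} = insert i N"
        using A[OF x] i' by (auto simp: N_def)
      have bf: "bij_betw f (P \<union> R) (A - {x} \<union> V)" "f ` P \<subseteq> V"
        using f by (auto simp: fillings_def bijs_def)
      have "bij_betw f {j \<in> N. f j < x} {y \<in> A. y < x}"
        unfolding bij_betw_def
      proof
        show "inj_on f {j \<in> N. f j < x}"
          using bf(1) by (auto simp: bij_betw_def N_def intro: inj_on_subset)
        show "f ` {j \<in> N. f j < x} = {y \<in> A. y < x}"
        proof (intro equalityI subsetI)
          fix y assume "y \<in> f ` {j \<in> N. f j < x}"
          then obtain j where j: "j \<in> N" "f j < x" "y = f j" by auto
          then have "y \<in> A - {x} \<union> V" using bf(1) by (auto simp: N_def bij_betw_def)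
          moreover have "y \<notin> V" using V[of y] j A[OF x] by force
          ultimately show "y \<in> {y \<in> A. y < x}" using j by auto
        next
          fix y assume y: "y \<in> {y \<in> A. y < x}"
          then have "y \<in> A - {x} \<union> V" by auto
          then obtain j where j: "j \<in> P \<union> R" "y = f j"
            using bf(1) unfolding bij_betw_def by (metis imageE)
          then have "j \<in> R" using bf(2) y AV by auto
          moreover have "f j < thr j" using thr[OF \<open>j \<in> R\<close>] A[of y] y j by auto
          ultimately show "y \<in> f ` {j \<in> N. f j < x}"
            using y j by (auto simp: N_def)
        qed
      qed
      then have c: "card {j \<in> N. f j < x} = card {y \<in> A. y < x}"
        by (rule bij_betw_same_card)
      have "inv_on (f(i := x)) (insert i N) = inv_on f N + card {y \<in> A. y < x}"
      proof -
        have "{j \<in> N. i < j \<and> (f(i := x)) j < (f(i := x)) i} = {j \<in> N. f j < x}"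
          "{j \<in> N. j < i \<and> (f(i := x)) i < (f(i := x)) j} = {}"
          using i(2) iE by (auto simp: N_def dest: less_asym)
        moreover have "inv_on (f(i := x)) N = inv_on f N"
          using iE by (intro inv_on_cong) auto
        ultimately show ?thesis
          using iE fin c by (subst inv_on_insert) (auto simp: N_def)
      qed
      moreover have "inv_on (f(i := x)) (P \<union> E) = inv_on f (P \<union> E)"
        using iE by (intro inv_on_cong) auto
      ultimately show ?thesis
        unfolding exc_weight_def eE eN by (simp add: E_def N_def power_add)
    qed
    show "(\<Sum>f\<in>F x. exc_weight q w thr P (insert i R) f) =
        q ^ card {y \<in> A. y < x} * filling_sum q w thr P R (A - {x}) V"
      unfolding sum.reindex_bij_betw[OF bij, symmetric] filling_sum_def sum_distrib_left
      by (rule sum.cong[OF refl]) (rule wt)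
  qed
  also have "(\<Sum>f\<in>D. exc_weight q w thr P (insert i R) f) = w i * filling_sum q w thr (insert i P) R A V"
    unfolding filling_sum_def D_def[symmetric] sum_distrib_left
  proof (rule sum.cong[OF refl])
    fix f assume "f \<in> D"
    then have fi: "thr i \<le> f i" using V by (auto simp: D)
    then have "{j \<in> insert i R. thr j \<le> f j} = insert i {j \<in> R. thr j \<le> f j}"
      "{j \<in> insert i R. f j < thr j} = {j \<in> R. f j < thr j}"
      by auto
    then show "exc_weight q w thr P (insert i R) f = w i * exc_weight q w thr (insert i P) R f"
      using i' fin by (simp add: exc_weight_def)
  qed
  finally show ?thesis .
qed

text \<open>Either \<open>v\<close> is left to a later place and joins \<open>A\<close>, or it
  closes an open place \<open>i\<close>. Then all other excedance letters still to come exceed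
  \<open>v\<close>, so its inversions are with the open places left of \<open>i\<close>.\<close>

lemma filling_sum_value:
  assumes fin: "finite P" "finite R" "finite A" "finite V"
    and PR: "\<And>i j. i \<in> P \<Longrightarrow> j \<in> R \<Longrightarrow> i < j"
    and A: "\<And>x. x \<in> A \<Longrightarrow> x < v" and V: "\<And>x. x \<in> V \<Longrightarrow> v < x"
    and thr: "\<And>j. j \<in> R \<Longrightarrow> v < thr j"
  shows "filling_sum q w thr P R A (insert v V) =
    filling_sum q w thr P R (insert v A) V
    + (\<Sum>i\<in>P. q ^ card {j \<in> P. j < i} * filling_sum q w thr (P - {i}) R A V)"
proof -
  define F where "F i = {f \<in> fillings P R A (insert v V). f i = v}" for i
  define D where "D = fillings P R (insert v A) V"
  have PR': "P \<inter> R = {}" using PR by force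
  have v: "v \<notin> A" "v \<notin> V" using A V by auto
  have fin': "finite (fillings P R A (insert v V))"
    using fin by (simp add: finite_fillings)
  have D: "D = {f \<in> fillings P R A (insert v V). v \<notin> f ` P}"
    using v by (auto simp: D_def fillings_def)
  have split: "fillings P R A (insert v V) = D \<union> (\<Union>i\<in>P. F i)"
    by (auto simp: D F_def)
  have inj: "inj_on f (P \<union> R)" if "f \<in> fillings P R A (insert v V)" for f
    using that by (auto simp: fillings_def bijs_def bij_betw_def)
  have "filling_sum q w thr P R A (insert v V) =
      (\<Sum>f\<in>D. exc_weight q w thr P R f) + (\<Sum>f\<in>(\<Union>i\<in>P. F i). exc_weight q w thr P R f)"
    unfolding filling_sum_def split
  proof (rule sum.union_disjoint)
    show "finite (\<Union>i\<in>P. F i)" "finite D"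
      by (rule finite_subset[OF _ fin'], auto simp: split)+
    show "D \<inter> (\<Union>i\<in>P. F i) = {}" by (auto simp: F_def D)
  qed
  also have "(\<Sum>f\<in>(\<Union>i\<in>P. F i). exc_weight q w thr P R f) =
      (\<Sum>i\<in>P. \<Sum>f\<in>F i. exc_weight q w thr P R f)"
  proof (rule sum.UNION_disjoint)
    show "\<forall>i\<in>P. finite (F i)" using fin' by (auto simp: F_def)
    show "\<forall>i\<in>P. \<forall>j\<in>P. i \<noteq> j \<longrightarrow> F i \<inter> F j = {}"
    proof (intro ballI impI)
      fix i j assume ij: "i \<in> P" "j \<in> P" "i \<noteq> j"
      have False if "f \<in> F i" "f \<in> F j" for f
        using inj[of f] that ij by (auto simp: F_def inj_on_def)
      then show "F i \<inter> F j = {}" by auto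
    qed
  qed (auto simp: fin)
  also have "\<dots> = (\<Sum>i\<in>P. q ^ card {j \<in> P. j < i} * filling_sum q w thr (P - {i}) R A V)"
  proof (rule sum.cong[OF refl])
    fix i assume i: "i \<in> P"
    then have iR: "i \<notin> R" using PR' by auto
    have bij: "bij_betw (\<lambda>f. f(i := v)) (fillings (P - {i}) R A V) (F i)"
    proof -
      have "v \<notin> A \<union> V" "i \<notin> P - {i} \<union> R" using v iR by auto
      moreover have "insert i (P - {i} \<union> R) = P \<union> R" "insert v (A \<union> V) = A \<union> insert v V"
        using i by auto
      ultimately have b: "bij_betw (\<lambda>f. f(i := v)) (bijs (P - {i} \<union> R) (A \<union> V))
         {f \<in> bijs (P \<union> R) (A \<union> insert v V). f i = v}"
        using bij_betw_bijs_update[of i "P - {i} \<union> R" v "A \<union> V"] by simp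
      have "bij_betw (\<lambda>f. f(i := v)) {f \<in> bijs (P - {i} \<union> R) (A \<union> V). f ` (P - {i}) \<subseteq> V}
         {f \<in> {f \<in> bijs (P \<union> R) (A \<union> insert v V). f i = v}. f ` (P - {i}) \<subseteq> V}"
      proof (rule bij_betw_Collect[OF b])
        show "(f(i := v)) ` (P - {i}) \<subseteq> V \<longleftrightarrow> f ` (P - {i}) \<subseteq> V" for f
          by auto
      qed
      moreover have "{f \<in> {f \<in> bijs (P \<union> R) (A \<union> insert v V). f i = v}. f ` (P - {i}) \<subseteq> V} = F i"
      proof -
        have "f ` P \<subseteq> insert v V \<longleftrightarrow> f ` (P - {i}) \<subseteq> V"
          if "f \<in> bijs (P \<union> R) (A \<union> insert v V)" "f i = v" for f
        proof -
          have "inj_on f (P \<union> R)" using that by (auto simp: bijs_def bij_betw_def)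
          then have "f j \<noteq> v" if "j \<in> P - {i}" for j
            using that i \<open>f i = v\<close> unfolding inj_on_def by blast
          then show ?thesis using that by blast
        qed
        then show ?thesis by (auto simp: F_def fillings_def)
      qed
      ultimately show ?thesis by (simp add: fillings_def)
    qed
    have wt: "exc_weight q w thr P R (f(i := v)) =
        q ^ card {j \<in> P. j < i} * exc_weight q w thr (P - {i}) R f"
      if f: "f \<in> fillings (P - {i}) R A V" for f
    proof -
      define E where "E = {j \<in> R. thr j \<le> f j}"
      define N where "N = {j \<in> R. f j < thr j}"
      have iE: "i \<notin> P - {i} \<union> E" "i \<notin> N" using iR by (auto simp: E_def N_def)
      have eE: "{j \<in> R. thr j \<le> (f(i := v)) j} = E" "{j \<in> R. (f(i := v)) j < thr j} = N"
        using iR by (auto simp: E_def N_def)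
      have PE: "P \<union> E = insert i (P - {i} \<union> E)" using i by auto
      have gt: "v < f j" if "j \<in> P - {i} \<union> E" for j
        using that f V thr[of j] by (auto simp: fillings_def E_def)
      have "inv_on (f(i := v)) (P \<union> E) = inv_on f (P - {i} \<union> E) + card {j \<in> P. j < i}"
      proof -
        have "{j \<in> P - {i} \<union> E. i < j \<and> (f(i := v)) j < (f(i := v)) i} = {}"
          using gt by (auto dest: less_asym)
        moreover have "{j \<in> P - {i} \<union> E. j < i \<and> (f(i := v)) i < (f(i := v)) j} = {j \<in> P. j < i}"
          using gt PR[OF i] by (auto simp: E_def dest: less_asym)
        moreover have "inv_on (f(i := v)) (P - {i} \<union> E) = inv_on f (P - {i} \<union> E)"
          using iE by (intro inv_on_cong) auto
        ultimately show ?thesis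
          unfolding PE using iE fin by (subst inv_on_insert) (auto simp: E_def)
      qed
      moreover have "inv_on (f(i := v)) N = inv_on f N"
        using iE by (intro inv_on_cong) auto
      ultimately show ?thesis
        unfolding exc_weight_def eE by (simp add: E_def N_def power_add)
    qed
    show "(\<Sum>f\<in>F i. exc_weight q w thr P R f) =
        q ^ card {j \<in> P. j < i} * filling_sum q w thr (P - {i}) R A V"
      unfolding sum.reindex_bij_betw[OF bij, symmetric] filling_sum_def sum_distrib_left
      by (rule sum.cong[OF refl]) (rule wt)
  qed
  finally show ?thesis unfolding D_def filling_sum_def[symmetric] .
qed

section \<open>Iterated raising operators, for the places below the level\<close>

primrec q_raises :: "real \<Rightarrow> nat \<Rightarrow> (nat \<Rightarrow> real) \<Rightarrow> nat \<Rightarrow> (nat \<Rightarrow> real) \<Rightarrow> nat \<Rightarrow> real" where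
  "q_raises q d u 0 y = y"
| "q_raises q d u (Suc k) y = q_raise q (d + Suc k) (u k) (q_raises q d u k y)"

text \<open>\<open>q_raise_swap\<close> moves \<open>w\<close> past each factor: weights trade
  positions while parameters stay, so the other factors end with parameters raised by one.\<close>

lemma q_raise_raises:
  "q_raise q (d + Suc k) w (q_raises q d u k y) = q_raises q (Suc d) u k (q_raise q (Suc d) w y)"
proof (induction k)
  case (Suc k)
  then show ?case
    by (simp add: q_raise_swap[of q "Suc (d + k)" w])
qed simp

text \<open>The outermost factor, having the smallest exponent, is moved to the innermost position,
  where it raises the parameter of the path.\<close>

lemma q_raises_path:
  assumes "\<And>j. j < k \<Longrightarrow> u j = q ^ (d + k - Suc j)"
  shows "q_raises q d u k (q_path q d w s) = q_path q (d + k) w s"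
  using assms
proof (induction k arbitrary: d)
  case (Suc k)
  have "q_raises q d u (Suc k) (q_path q d w s) = q_raises q (Suc d) u k (q_path q (Suc d) w s)"
    using Suc.prems[of k] q_raise_raises[of q d k "q ^ d" u "q_path q d w s"]
    by (simp add: q_raise_path)
  also have "\<dots> = q_path q (Suc d + k) w s"
    using Suc.prems by (intro Suc.IH) simp
  finally show ?case by simp
qed simp

text \<open>All values are below all thresholds, so no place is an excedance place, and removing the
  smallest place splits off one q-integer.\<close>

lemma filling_sum_no_exc:
  assumes "finite R" "finite A" "card R = card A"
    and "\<And>x i. x \<in> A \<Longrightarrow> i \<in> R \<Longrightarrow> x < thr i"
    and "\<And>i j. i \<in> R \<Longrightarrow> j \<in> R \<Longrightarrow> i \<le> j \<Longrightarrow> thr i \<le> thr j"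
  shows "filling_sum q w thr {} R A {} = q_fact q (card A)"
  using assms
proof (induction "card A" arbitrary: R A)
  case 0
  then show ?case by (simp add: filling_sum_empty)
next
  case (Suc k)
  define i where "i = Min R"
  have "R \<noteq> {}" using Suc by auto
  then have i: "i \<in> R" "\<And>j. j \<in> R \<Longrightarrow> i \<le> j"
    using Suc.prems(1) by (auto simp: i_def)
  have R: "R = insert i (R - {i})" using i by auto
  have lt: "i < j" if "j \<in> R - {i}" for j
    using i(2)[of j] that by auto
  have "filling_sum q w thr {} R A {} =
     (\<Sum>x\<in>A. q ^ card {y \<in> A. y < x} * filling_sum q w thr {} (R - {i}) (A - {x}) {})
      + w i * filling_sum q w thr (insert i {}) (R - {i}) A {}"
    by (subst R, rule filling_sum_place) (use Suc.prems i lt in auto)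
  \<comment> \<open>The summand that opens \<open>i\<close> vanishes, no value being left to close
    it.\<close>
  also have "\<dots> = (\<Sum>x\<in>A. q ^ card {y \<in> A. y < x} * q_fact q k)"
  proof -
    have "filling_sum q w thr {} (R - {i}) (A - {x}) {} = q_fact q k" if "x \<in> A" for x
    proof -
      have k: "k = card (A - {x})" using Suc.hyps(2) that by simp
      show ?thesis
        unfolding k by (rule Suc.hyps(1)[OF k]) (use Suc.prems that i in auto)
    qed
    then show ?thesis by (simp add: filling_sum_no_values)
  qed
  also have "\<dots> = q_fact q (card A)"
    using Suc.hyps(2) by (simp add: sum_distrib_right[symmetric] sum_power_rank Suc.prems q_fact_Suc flip: Suc.hyps(2))
  finally show ?case .
qed

section \<open>The scan with threshold \<open>max i l + g\<close>\<close>

context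
  fixes g l n :: nat and q :: real and w :: "nat \<Rightarrow> real" and thr :: "nat \<Rightarrow> nat"
  assumes thr: "\<And>i. thr i = max i l + g"
begin

lemma filling_sum_path:
  assumes "n = p + g + s" "l \<le> Suc p" "P \<subseteq> {..p}" "A \<subseteq> {..p + g}" "card A = g + card P"
  shows "filling_sum q w thr P {p<..n} A {p + g<..n} = q_path q g (\<lambda>s. w (n - g - s)) s (card P)"
  using assms
proof (induction s arbitrary: p P A)
  case 0
  have fin: "finite P" "finite A" using 0 by (auto intro: finite_subset)
  show ?case
  proof (cases "P = {}")
    case True
    have "card A = g" "n = p + g" using 0 True by simp_all
    then have "filling_sum q w thr {} {p<..n} A {} = q_fact q (card A)"
      using \<open>A \<subseteq> {..p + g}\<close> fin(2) by (intro filling_sum_no_exc) (auto simp: thr)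
    then show ?thesis using 0 True by simp
  next
    case False
    then have "card P \<noteq> 0" using fin by simp
    then show ?thesis using 0 False by (simp add: filling_sum_no_values)
  qed
next
  case (Suc s)
  define y where "y = q_path q g (\<lambda>s. w (n - g - s)) s"
  define v where "v = Suc (p + g)"
  have fin: "finite P" "finite A" using Suc.prems by (auto intro: finite_subset)
  have n: "n = Suc p + g + s" using Suc.prems by simp
  have sets: "{p<..n} = insert (Suc p) {Suc p<..n}" "{p + g<..n} = insert v {Suc p + g<..n}"
    using n by (auto simp: v_def)
  \<comment> \<open>The value half of a double step. The place before it took a value or opened,
    hence the successor in the size condition.\<close>
  have step: "filling_sum q w thr P' {Suc p<..n} A' {p + g<..n} =
      y (card P') + q_num q (card P') * y (card P' - 1)"
    if P': "P' \<subseteq> {..Suc p}" and A': "A' \<subseteq> {..p + g}" and c: "Suc (card A') = g + card P'" for P' A'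
  proof -
    have fin': "finite P'" "finite A'" using P' A' by (auto intro: finite_subset)
    have vA: "v \<notin> A'" using A' by (auto simp: v_def)
    have "filling_sum q w thr P' {Suc p<..n} A' (insert v {Suc p + g<..n}) =
       filling_sum q w thr P' {Suc p<..n} (insert v A') {Suc p + g<..n}
       + (\<Sum>i\<in>P'. q ^ card {j \<in> P'. j < i} * filling_sum q w thr (P' - {i}) {Suc p<..n} A' {Suc p + g<..n})"
      using P' A' fin' by (intro filling_sum_value) (auto simp: v_def thr)
    also have "filling_sum q w thr P' {Suc p<..n} (insert v A') {Suc p + g<..n} = y (card P')"
      unfolding y_def using n P' A' c fin' vA Suc.prems
      by (intro Suc.IH) (auto simp: v_def)
    also have "(\<Sum>i\<in>P'. q ^ card {j \<in> P'. j < i} * filling_sum q w thr (P' - {i}) {Suc p<..n} A' {Suc p + g<..n})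
        = (\<Sum>i\<in>P'. q ^ card {j \<in> P'. j < i} * y (card P' - 1))"
    proof (rule sum.cong[OF refl])
      fix i assume i: "i \<in> P'"
      then have ci: "card (P' - {i}) = card P' - 1" "card P' \<noteq> 0" using fin' by auto
      have "filling_sum q w thr (P' - {i}) {Suc p<..n} A' {Suc p + g<..n} = y (card (P' - {i}))"
        unfolding y_def
      proof (rule Suc.IH[OF n])
        show "card A' = g + card (P' - {i})" using c ci by simp
      qed (use P' A' Suc.prems in auto)
      then show "q ^ card {j \<in> P'. j < i} * filling_sum q w thr (P' - {i}) {Suc p<..n} A' {Suc p + g<..n}
        = q ^ card {j \<in> P'. j < i} * y (card P' - 1)" by (simp add: ci)
    qed
    finally show ?thesis
      by (simp add: sets(2) sum_distrib_right[symmetric] sum_power_rank fin')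
  qed
  have "filling_sum q w thr P (insert (Suc p) {Suc p<..n}) A {p + g<..n} =
     (\<Sum>x\<in>A. q ^ card {y \<in> A. y < x} * filling_sum q w thr P {Suc p<..n} (A - {x}) {p + g<..n})
     + w (Suc p) * filling_sum q w thr (insert (Suc p) P) {Suc p<..n} A {p + g<..n}"
    using Suc.prems fin by (intro filling_sum_place) (auto simp: thr max_def subset_iff le_Suc_eq)
  also have "(\<Sum>x\<in>A. q ^ card {y \<in> A. y < x} * filling_sum q w thr P {Suc p<..n} (A - {x}) {p + g<..n})
     = (\<Sum>x\<in>A. q ^ card {y \<in> A. y < x} * (y (card P) + q_num q (card P) * y (card P - 1)))"
  proof (rule sum.cong[OF refl])
    fix x assume "x \<in> A"
    then have "Suc (card (A - {x})) = g + card P"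
      using fin Suc.prems by (metis card_Suc_Diff1)
    then have "filling_sum q w thr P {Suc p<..n} (A - {x}) {p + g<..n} =
        y (card P) + q_num q (card P) * y (card P - 1)"
      using Suc.prems by (intro step) auto
    then show "q ^ card {y \<in> A. y < x} * filling_sum q w thr P {Suc p<..n} (A - {x}) {p + g<..n} =
      q ^ card {y \<in> A. y < x} * (y (card P) + q_num q (card P) * y (card P - 1))" by simp
  qed
  also have "filling_sum q w thr (insert (Suc p) P) {Suc p<..n} A {p + g<..n} =
      y (Suc (card P)) + q_num q (Suc (card P)) * y (card P)"
  proof -
    have "Suc p \<notin> P" using Suc.prems by auto
    then have "card (insert (Suc p) P) = Suc (card P)" using fin by simp
    moreover have "filling_sum q w thr (insert (Suc p) P) {Suc p<..n} A {p + g<..n} =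
      y (card (insert (Suc p) P)) + q_num q (card (insert (Suc p) P)) * y (card (insert (Suc p) P) - 1)"
      using Suc.prems calculation by (intro step) auto
    ultimately show ?thesis by simp
  qed
  also have "(\<Sum>x\<in>A. q ^ card {y \<in> A. y < x} * (y (card P) + q_num q (card P) * y (card P - 1)))
      = q_num q (g + card P) * (y (card P) + q_num q (card P) * y (card P - 1))"
    by (simp only: sum_distrib_right[symmetric] sum_power_rank[OF fin(2)] Suc.prems)
  moreover have "w (n - g - s) = w (Suc p)" using n by simp
  ultimately show ?case
    unfolding sets(1) q_path.simps y_def[symmetric] by (simp add: algebra_simps)
qed

text \<open>The places below \<open>l\<close> share the threshold \<open>r + 1\<close>, so they are
  met in a row with no value in between. Place \<open>m\<close> comes last and gives the innermost
  factor.\<close>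

lemma filling_sum_raises:
  assumes "r = g + m" "m + 1 = l" "r \<le> n"
    and "p + k = m" "P \<subseteq> {..p}" "A \<subseteq> {..r}" "card A = g + k + card P"
  shows "filling_sum q w thr P {p<..n} A {r<..n} =
    q_raises q g (\<lambda>j. w (m - j)) k (q_path q g (\<lambda>s. w (n - g - s)) (n - r)) (card P)"
  using assms(4-)
proof (induction k arbitrary: p P A)
  case 0
  then have "r = p + g" using assms by simp
  then show ?case
    using 0 assms(1-3) filling_sum_path[of p "n - r" P A] by (simp add: add.commute[of m g])
next
  case (Suc k)
  define y where "y = q_raises q g (\<lambda>j. w (m - j)) k (q_path q g (\<lambda>s. w (n - g - s)) (n - r))"
  have fin: "finite P" "finite A" using Suc.prems by (auto intro: finite_subset)
  have pn: "{p<..n} = insert (Suc p) {Suc p<..n}"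
    using Suc.prems assms(1-3) by auto
  have "filling_sum q w thr P (insert (Suc p) {Suc p<..n}) A {r<..n} =
     (\<Sum>x\<in>A. q ^ card {y \<in> A. y < x} * filling_sum q w thr P {Suc p<..n} (A - {x}) {r<..n})
     + w (Suc p) * filling_sum q w thr (insert (Suc p) P) {Suc p<..n} A {r<..n}"
  proof (rule filling_sum_place)
    have e: "thr (Suc p) = Suc r" using Suc.prems assms(1-3) by (simp add: thr max_def)
    show "x < thr (Suc p)" if "x \<in> A" for x using Suc.prems that e by auto
    show "thr (Suc p) \<le> x" if "x \<in> {r<..n}" for x using that e by auto
    show "thr (Suc p) \<le> thr j" if "j \<in> {Suc p<..n}" for j using that by (auto simp: thr max_def)
    show "j < Suc p" if "j \<in> P" for j using Suc.prems that by auto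
  qed (use fin in auto)
  also have "(\<Sum>x\<in>A. q ^ card {y \<in> A. y < x} * filling_sum q w thr P {Suc p<..n} (A - {x}) {r<..n})
     = (\<Sum>x\<in>A. q ^ card {y \<in> A. y < x} * y (card P))"
  proof (rule sum.cong[OF refl])
    fix x assume "x \<in> A"
    then have "Suc (card (A - {x})) = g + Suc k + card P"
      using fin Suc.prems by (metis card_Suc_Diff1)
    then have "filling_sum q w thr P {Suc p<..n} (A - {x}) {r<..n} = y (card P)"
      unfolding y_def using Suc.prems by (intro Suc.IH) auto
    then show "q ^ card {y \<in> A. y < x} * filling_sum q w thr P {Suc p<..n} (A - {x}) {r<..n} =
      q ^ card {y \<in> A. y < x} * y (card P)" by simp
  qed
  also have "filling_sum q w thr (insert (Suc p) P) {Suc p<..n} A {r<..n} = y (Suc (card P))"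
  proof -
    have "Suc p \<notin> P" using Suc.prems by auto
    then have c: "card (insert (Suc p) P) = Suc (card P)" using fin by simp
    have "filling_sum q w thr (insert (Suc p) P) {Suc p<..n} A {r<..n} = y (card (insert (Suc p) P))"
      unfolding y_def using Suc.prems c by (intro Suc.IH) auto
    then show ?thesis by (simp add: c)
  qed
  also have "(\<Sum>x\<in>A. q ^ card {y \<in> A. y < x} * y (card P)) = q_num q (g + Suc k + card P) * y (card P)"
    by (simp only: sum_distrib_right[symmetric] sum_power_rank[OF fin(2)] Suc.prems)
  moreover have "Suc p = m - k" using Suc.prems by simp
  ultimately show ?case
    unfolding pn q_raises.simps y_def[symmetric] q_raise_def by simp
qed

text \<open>From the innermost factor outwards the weights are \<open>q ^ (r - 1)\<close> down to
  \<open>q ^ g\<close>, as \<open>q_raises_path\<close> requires; so the parameter climbs from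
  \<open>g\<close> to \<open>r\<close>.\<close>

lemma filling_sum_all:
  assumes "r = g + m" "m + 1 = l" "r \<le> n"
    and w: "\<And>i. 1 \<le> i \<Longrightarrow> i \<le> m \<Longrightarrow> w i = q ^ (i + g - 1)"
  shows "filling_sum q w thr {} {1..n} {1..r} {r<..n} = q_path q r (\<lambda>s. w (n - g - s)) (n - r) 0"
proof -
  have "filling_sum q w thr {} {0<..n} {1..r} {r<..n} =
      q_raises q g (\<lambda>j. w (m - j)) m (q_path q g (\<lambda>s. w (n - g - s)) (n - r)) (card ({} :: nat set))"
    using assms by (intro filling_sum_raises) auto
  also have "\<dots> = q_path q r (\<lambda>s. w (n - g - s)) (n - r) 0"
    using w by (subst q_raises_path) (simp_all add: assms(1) Suc_diff_Suc add.commute)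
  also have "{0<..n} = {1..n}" by auto
  finally show ?thesis .
qed

end

subsection \<open>Insertion of the maximum\<close>

definition insert_max :: "nat \<Rightarrow> nat \<Rightarrow> (nat \<Rightarrow> nat) \<Rightarrow> nat \<Rightarrow> nat" where
  "insert_max n j p i =
     (if i \<le> j then p i else if i = Suc j then Suc n else if i \<le> Suc n then p (i - 1) else i)"

lemma permutes_range: "p permutes {1..n} \<Longrightarrow> 1 \<le> i \<Longrightarrow> i \<le> n \<Longrightarrow> 1 \<le> p i \<and> p i \<le> n"
  using permutes_in_image[of p "{1..n}" i] by auto

lemma insert_max_permutes:
  assumes p: "p permutes {1..n}" and j: "j \<le> n"
  shows "insert_max n j p permutes {1..Suc n}"
proof (rule bij_imp_permutes)
  note rng = permutes_range[OF p]
  have inj: "p i = p k \<longleftrightarrow> i = k" for i k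
    using permutes_inj[OF p] by (auto simp: inj_def)
  have n: "p i \<noteq> Suc n" if "i \<le> n" for i
    using rng[of i] that permutes_not_in[OF p, of i] by (cases "i = 0") auto
  have "inj_on (insert_max n j p) {1..Suc n}"
  proof (rule inj_onI)
    fix i k assume ik: "i \<in> {1..Suc n}" "k \<in> {1..Suc n}"
      and eq: "insert_max n j p i = insert_max n j p k"
    have "p (i - 1) \<noteq> Suc n" "p (k - 1) \<noteq> Suc n" using ik by (auto intro!: n)
    moreover have "i \<le> j \<Longrightarrow> p i \<noteq> Suc n" "k \<le> j \<Longrightarrow> p k \<noteq> Suc n" using j by (auto intro!: n)
    ultimately show "i = k"
      using ik eq by (auto simp: insert_max_def inj split: if_splits)
  qed
  moreover have "insert_max n j p ` {1..Suc n} \<subseteq> {1..Suc n}"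
  proof
    fix y assume "y \<in> insert_max n j p ` {1..Suc n}"
    then obtain i where i: "1 \<le> i" "i \<le> Suc n" "y = insert_max n j p i" by auto
    consider "i \<le> j" | "i = Suc j" | k where "i = Suc k" "j < k"
      by (metis Suc_less_eq Suc_lessI less_Suc_eq_le not_less_eq old.nat.exhaust zero_less_Suc not_less)
    then show "y \<in> {1..Suc n}"
    proof cases
      case 3
      then show ?thesis using i rng[of k] by (auto simp: insert_max_def)
    qed (use i j rng[of i] in \<open>auto simp: insert_max_def\<close>)
  qed
  ultimately show "bij_betw (insert_max n j p) {1..Suc n} {1..Suc n}"
    by (simp add: bij_betw_def endo_inj_surj)
  show "insert_max n j p i = i" if "i \<notin> {1..Suc n}" for i
    using that j permutes_not_in[OF p, of i] by (auto simp: insert_max_def)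
qed

text \<open>The position of the letter \<open>n + 1\<close> gives back the slot, the other letters
  give back \<open>p\<close>; surjectivity follows by counting.\<close>

lemma bij_betw_insert_max:
  "bij_betw (\<lambda>(p, j). insert_max n j p) ({p. p permutes {1..n}} \<times> {..n}) {p. p permutes {1..Suc n}}"
proof -
  let ?F = "\<lambda>(p, j). insert_max n j p" and ?A = "{p. p permutes {1..n}} \<times> {..n}"
  have "inj_on ?F ?A"
  proof (rule inj_onI)
    fix x y assume xy: "x \<in> ?A" "y \<in> ?A" "?F x = ?F y"
    obtain p j p' j' where x: "x = (p, j)" and y: "y = (p', j')" by (cases x, cases y)
    have p: "p permutes {1..n}" "p' permutes {1..n}" and j: "j \<le> n" "j' \<le> n"
      and eq: "insert_max n j p i = insert_max n j' p' i" for i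
      using xy x y by (auto dest: fun_cong)
    have jj: "j = j'"
      using eq[of "Suc j"] j permutes_range[OF p(2), of "Suc j"] permutes_range[OF p(2), of j]
      by (auto simp: insert_max_def split: if_splits)
    have "p i = p' i" for i
    proof (cases "i \<le> j \<or> n < i")
      case True
      then show ?thesis
        using eq[of i] jj permutes_not_in[OF p(1), of i] permutes_not_in[OF p(2), of i]
        by (auto simp: insert_max_def)
    next
      case False
      then show ?thesis using eq[of "Suc i"] jj by (auto simp: insert_max_def)
    qed
    with jj x y show "x = y" by auto
  qed
  moreover have "?F ` ?A \<subseteq> {p. p permutes {1..Suc n}}"
    using insert_max_permutes by auto
  moreover have "card ?A = card {p. p permutes {1..Suc n}}"
    by (simp add: card_cartesian_product card_permutations[OF refl])
  moreover have "finite {p. p permutes {1..Suc n}}" by (simp add: finite_permutations)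
  ultimately show ?thesis
    unfolding bij_betw_def by (metis card_image card_subset_eq)
qed

text \<open>Slot \<open>k\<close> lies between the letters at \<open>k\<close> and \<open>Suc k\<close>. Inserting the new maximum there preserves
  the number of \<open>r\<close>-descents exactly for the slots below and for the final slot \<open>n\<close>.\<close>

definition stable_slots :: "nat \<Rightarrow> nat \<Rightarrow> (nat \<Rightarrow> nat) \<Rightarrow> nat set" where
  "stable_slots r n p = {k. k < n \<and> (k \<in> rDes r n p \<or> Suc n < p (Suc k) + r)}"

lemma finite_rDes [simp]: "finite (rDes r n p)"
  by (simp add: rDes_def)

text \<open>The maximum destroys a descent at its slot, shifts later ones, and starts a new one if
  the next letter is small enough.\<close>

lemma rDes_insert_max:
  assumes p: "p permutes {1..n}" and j: "j \<le> n" and r: "r \<ge> 1"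
  shows "rDes r (Suc n) (insert_max n j p) =
    {i \<in> rDes r n p. i < j} \<union> Suc ` {i \<in> rDes r n p. j < i}
    \<union> (if j < n \<and> p (Suc j) + r \<le> Suc n then {Suc j} else {})"
    (is "?L = ?R")
proof (rule set_eqI)
  fix i
  consider "i = 0" | "1 \<le> i" "i < j" | "i \<ge> 1" "i = j" | "i = Suc j" | "Suc j < i" by linarith
  then show "i \<in> ?L \<longleftrightarrow> i \<in> ?R"
  proof cases
    case 3
    then have "p j < Suc n" using permutes_range[OF p, of j] j by auto
    then show ?thesis using 3 r by (auto simp: rDes_def insert_max_def)
  next
    case 5
    then obtain k where k: "i = Suc k" "j < k" by (cases i) auto
    then show ?thesis by (auto simp: rDes_def insert_max_def)
  qed (use j in \<open>auto simp: rDes_def insert_max_def\<close>)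
qed

lemma card_rInv_insert_max:
  assumes p: "p permutes {1..n}" and j: "j \<le> n"
  shows "card (rInv r (Suc n) (insert_max n j p)) =
    card (rInv r n p) + card {k. j \<le> k \<and> k < n \<and> Suc n < p (Suc k) + r}"
proof -
  \<comment> \<open>Old places go to new ones, skipping the place of the new letter.\<close>
  define \<phi> where "\<phi> i = (if i \<le> j then i else Suc i)" for i
  define B where "B = {k. j \<le> k \<and> k < n \<and> Suc n < p (Suc k) + r}"
  have inj: "inj \<phi>" by (auto simp: inj_def \<phi>_def)
  have ins: "insert_max n j p (\<phi> i) = p i" if "i \<le> n" for i
    using that by (auto simp: insert_max_def \<phi>_def)
  have ins': "insert_max n j p (Suc j) = Suc n" by (simp add: insert_max_def)
  have mono: "\<phi> i < \<phi> k \<longleftrightarrow> i < k" for i k by (auto simp: \<phi>_def)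
  have lt: "p i < Suc n" if "1 \<le> i" "i \<le> n" for i
    using permutes_range[OF p, of i] that by auto
  have cases: "i = Suc j \<or> (\<exists>k\<in>{1..n}. i = \<phi> k)" if "i \<in> {1..Suc n}" for i
  proof (cases "i \<le> j")
    case True
    then have "i \<in> {1..n}" "i = \<phi> i" using that j by (auto simp: \<phi>_def)
    then show ?thesis by blast
  next
    case False
    show ?thesis
    proof (cases "i = Suc j")
      case False
      then have "i - 1 \<in> {1..n}" "i = \<phi> (i - 1)" using that \<open>\<not> i \<le> j\<close> by (auto simp: \<phi>_def)
      then show ?thesis by blast
    qed simp
  qed
  have rng: "\<phi> k \<in> {1..Suc n}" if "k \<in> {1..n}" for k using that by (auto simp: \<phi>_def)
  have "rInv r (Suc n) (insert_max n j p) = map_prod \<phi> \<phi> ` rInv r n p \<union> (\<lambda>k. (Suc j, Suc (Suc k))) ` B"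
    (is "?L = ?R1 \<union> ?R2")
  proof (intro equalityI subsetI)
    fix x assume "x \<in> ?L"
    then obtain a b where x: "x = (a, b)" and ab: "a \<in> {1..Suc n}" "b \<in> {1..Suc n}" "a < b"
      "insert_max n j p a > insert_max n j p b" "insert_max n j p a < insert_max n j p b + r"
      by (auto simp: rInv_def)
    have "insert_max n j p a \<le> Suc n"
      using permutes_range[OF insert_max_permutes[OF p j], of a] ab by auto
    then have "b \<noteq> Suc j" using ab ins' by auto
    then obtain b' where b': "b' \<in> {1..n}" "b = \<phi> b'" using cases[OF ab(2)] by auto
    show "x \<in> ?R1 \<union> ?R2"
    proof (cases "a = Suc j")
      case True
      then have "b' > j" "b = Suc b'" using ab b' by (auto simp: \<phi>_def split: if_splits)
      then have "b' - 1 \<in> B" "x = (Suc j, Suc (Suc (b' - 1)))"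
        using ab b' True ins' ins[of b'] by (auto simp: B_def x)
      then show ?thesis by blast
    next
      case False
      then obtain a' where a': "a' \<in> {1..n}" "a = \<phi> a'" using cases[OF ab(1)] by auto
      then have "(a', b') \<in> rInv r n p"
        using ab b' ins[of a'] ins[of b'] by (auto simp: rInv_def mono)
      then show ?thesis using x a' b' by force
    qed
  next
    fix x assume "x \<in> ?R1 \<union> ?R2"
    then show "x \<in> ?L"
    proof
      assume "x \<in> ?R1"
      then obtain a b where "(a, b) \<in> rInv r n p" "x = (\<phi> a, \<phi> b)" by auto
      then show ?thesis
        using rng[of a] rng[of b] by (auto simp: rInv_def mono ins)
    next
      assume "x \<in> ?R2"
      then obtain k where k: "k \<in> B" "x = (Suc j, Suc (Suc k))" by auto
      then have "insert_max n j p (Suc (Suc k)) = p (Suc k)"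
        by (auto simp: B_def insert_max_def)
      then show ?thesis using k lt[of "Suc k"] j by (auto simp: rInv_def B_def ins')
    qed
  qed
  moreover have "?R1 \<inter> ?R2 = {}"
  proof -
    have "\<phi> i \<noteq> Suc j" for i by (auto simp: \<phi>_def)
    then show ?thesis by (auto simp: map_prod_def)
  qed
  moreover have "finite (rInv r n p)"
    by (rule finite_subset[of _ "{1..n} \<times> {1..n}"]) (auto simp: rInv_def)
  moreover have "finite B" by (rule finite_subset[of _ "{..<n}"]) (auto simp: B_def)
  moreover have "card ?R1 = card (rInv r n p)"
    by (rule card_image) (use map_prod_inj_on[of \<phi> UNIV \<phi> UNIV] inj in \<open>auto intro: inj_on_subset\<close>)
  moreover have "card ?R2 = card B"
    by (rule card_image) (auto simp: inj_on_def)
  ultimately show ?thesis by (simp add: card_Un_disjoint B_def[symmetric])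
qed

text \<open>The two kinds of stable slots exclude each other: at an \<open>r\<close>-descent
  \<open>k\<close>, \<open>p (Suc k) + r \<le> p k \<le> n\<close>.\<close>

lemma card_stable_slots_ge:
  assumes p: "p permutes {1..n}"
  shows "card {k \<in> stable_slots r n p. j \<le> k} =
    card {i \<in> rDes r n p. j \<le> i} + card {k. j \<le> k \<and> k < n \<and> Suc n < p (Suc k) + r}"
proof -
  have "{k \<in> stable_slots r n p. j \<le> k} =
     {i \<in> rDes r n p. j \<le> i} \<union> {k. j \<le> k \<and> k < n \<and> Suc n < p (Suc k) + r}"
    by (auto simp: stable_slots_def rDes_def)
  moreover have "{i \<in> rDes r n p. j \<le> i} \<inter> {k. j \<le> k \<and> k < n \<and> Suc n < p (Suc k) + r} = {}"
  proof -
    have "p (Suc k) + r \<le> n" if k: "k \<in> rDes r n p" for k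
    proof -
      have "1 \<le> k" "k \<le> n" "p (Suc k) + r \<le> p k" using k by (auto simp: rDes_def)
      then show ?thesis using permutes_range[OF p, of k] by linarith
    qed
    then show ?thesis by fastforce
  qed
  moreover have "finite {k. j \<le> k \<and> k < n \<and> Suc n < p (Suc k) + r}"
    by (rule finite_subset[of _ "{..<n}"]) auto
  ultimately show ?thesis by (simp add: card_Un_disjoint)
qed

text \<open>Each descent right of the slot moves by one, and each new \<open>r\<close>-inversion
  adds 1; with a descent at \<open>j\<close>, which moves to \<open>Suc j\<close>, these match the
  stable slots from \<open>j\<close> on.\<close>

lemma insert_max_stats:
  assumes p: "p permutes {1..n}" and j: "j \<le> n" and r: "r \<ge> 1"
  shows "rdes r (Suc n) (insert_max n j p) =
      rdes r n p + (if j \<in> stable_slots r n p \<or> j = n then 0 else 1)" (is ?d)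
    and "rmaj r (Suc n) (insert_max n j p) =
      rmaj r n p + card {k \<in> stable_slots r n p. j \<le> k}
        + (if j \<in> stable_slots r n p \<or> j = n then 0 else Suc j)" (is ?m)
proof -
  define D where "D = rDes r n p"
  define L where "L = {i \<in> D. i < j}"
  define U where "U = {i \<in> D. j < i}"
  define N where "N = (if j < n \<and> p (Suc j) + r \<le> Suc n then {Suc j} else {})"
  define M where "M = (if j \<in> D then {j} else {})"
  have fin: "finite D" "finite L" "finite U" "finite N" "finite M"
    by (auto simp: D_def L_def U_def N_def M_def)
  have "x \<in> D \<longleftrightarrow> x \<in> L \<union> M \<union> U" for x
    by (cases x j rule: linorder_cases) (auto simp: L_def M_def U_def)
  then have D: "D = L \<union> M \<union> U" by blast
  have D_disj: "L \<inter> M = {}" "(L \<union> M) \<inter> U = {}"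
    by (auto simp: L_def M_def U_def)
  have D': "rDes r (Suc n) (insert_max n j p) = L \<union> Suc ` U \<union> N"
    "L \<inter> Suc ` U = {}" "(L \<union> Suc ` U) \<inter> N = {}"
    unfolding rDes_insert_max[OF p j r] by (auto simp: L_def U_def N_def D_def)
  have jD: "p (Suc j) + r \<le> n" "j < n" if jD: "j \<in> D"
  proof -
    have *: "1 \<le> j" "j < n" "p (Suc j) + r \<le> p j" using jD by (auto simp: D_def rDes_def)
    then show "p (Suc j) + r \<le> n" "j < n" using permutes_range[OF p, of j] by linarith+
  qed
  have S: "j \<in> stable_slots r n p \<or> j = n \<longleftrightarrow> j \<in> D \<or> N = {}"
    using j jD by (auto simp: stable_slots_def N_def D_def)
  have N: "N = {Suc j}" if "j \<in> D" using jD[OF that] by (auto simp: N_def)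
  have N': "N = {} \<or> N = {Suc j}" by (auto simp: N_def)
  have cD: "card D = card L + card M + card U" "\<Sum>D = \<Sum>L + \<Sum>M + \<Sum>U"
    unfolding D using fin D_disj by (simp_all add: card_Un_disjoint sum.union_disjoint)
  have cD': "card (rDes r (Suc n) (insert_max n j p)) = card L + card U + card N"
    "\<Sum>(rDes r (Suc n) (insert_max n j p)) = \<Sum>L + (\<Sum>U + card U) + \<Sum>N"
    unfolding D'(1) using fin D'
    by (simp_all add: card_Un_disjoint sum.union_disjoint card_image sum.reindex sum_Suc)
  show ?d
    unfolding rdes_def cD' D_def[symmetric] cD S using N N' by (auto simp: M_def)
  have "x \<in> {i \<in> D. j \<le> i} \<longleftrightarrow> x \<in> M \<union> U" for x
    by (cases x j rule: linorder_cases) (auto simp: M_def U_def)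
  then have e: "{i \<in> D. j \<le> i} = M \<union> U" "M \<inter> U = {}"
    by (blast, auto simp: M_def U_def)
  then have "card {i \<in> D. j \<le> i} = card M + card U" using fin by (simp add: card_Un_disjoint)
  then show ?m
    unfolding rmaj_def cD' S card_rInv_insert_max[OF p j] card_stable_slots_ge[OF p] D_def[symmetric] cD
    using N N' by (auto simp: M_def)
qed

text \<open>The exponents are 1, ..., \<open>card S\<close> on the stable slots from right to left,
  and \<open>card S + 1\<close>, ..., \<open>n\<close> on the others from left to right.\<close>

lemma slot_sum:
  fixes q t :: real
  assumes "S \<subseteq> {..<n}"
  shows "(\<Sum>j<n. if j \<in> S then q ^ card {k \<in> S. j \<le> k} else t * q ^ (card {k \<in> S. j \<le> k} + Suc j)) =
    q_num q (Suc (card S)) - 1 + t * (q_num q (Suc n) - q_num q (Suc (card S)))"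
  using assms
proof (induction n arbitrary: S)
  case 0
  then show ?case by (simp add: q_num_Suc)
next
  case (Suc n)
  define S' where "S' = S - {n}"
  have S': "S' \<subseteq> {..<n}" using Suc.prems by (auto simp: S'_def less_Suc_eq)
  have fin: "finite S" "finite S'" using Suc.prems S' by (auto intro: finite_subset)
  show ?case
  proof (cases "n \<in> S")
    case True
    have "{k \<in> S. j \<le> k} = insert n {k \<in> S'. j \<le> k}" if "j \<le> n" for j
      using that True by (auto simp: S'_def)
    then have c: "card {k \<in> S. j \<le> k} = Suc (card {k \<in> S'. j \<le> k})" if "j \<le> n" for j
      using that fin by (simp add: S'_def)
    have "card S = Suc (card S')" using card.remove[OF fin(1) True] by (simp add: S'_def)
    moreover have e: "{k \<in> S'. n \<le> k} = {}" using S' by auto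
    then have "card {k \<in> S. n \<le> k} = 1"
      by (simp only: c[OF order_refl] e card.empty One_nat_def)
    moreover have "(\<Sum>j<n. if j \<in> S then q ^ card {k \<in> S. j \<le> k} else t * q ^ (card {k \<in> S. j \<le> k} + Suc j))
       = q * (\<Sum>j<n. if j \<in> S' then q ^ card {k \<in> S'. j \<le> k} else t * q ^ (card {k \<in> S'. j \<le> k} + Suc j))"
      unfolding sum_distrib_left by (rule sum.cong) (auto simp: c S'_def)
    ultimately show ?thesis
      unfolding sum.lessThan_Suc Suc.IH[OF S'] using True
      by (simp add: q_num_Suc'[of q "Suc _"] algebra_simps)
  next
    case False
    then have "S' = S" by (simp add: S'_def)
    moreover have "{k \<in> S. n \<le> k} = {}" using S' \<open>S' = S\<close> by auto
    then have "card {k \<in> S. n \<le> k} = 0" by (simp only: card.empty)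
    ultimately show ?thesis
      unfolding sum.lessThan_Suc Suc.IH[OF S', unfolded \<open>S' = S\<close>] using False
      by (simp add: q_num_Suc[of q "Suc n"] algebra_simps)
  qed
qed

section \<open>Recursion for the generating polynomial of \<open>(rdes, rmaj)\<close>\<close>

definition rdes_rmaj_sum :: "nat \<Rightarrow> real \<Rightarrow> nat \<Rightarrow> real \<Rightarrow> real" where
  "rdes_rmaj_sum r q n t = (\<Sum>p | p permutes {1..n}. t ^ rdes r n p * q ^ rmaj r n p)"

lemma rdes_rmaj_sum_Suc:
  assumes r: "r \<ge> 1"
  shows "rdes_rmaj_sum r q (Suc n) t =
    (\<Sum>p | p permutes {1..n}. t ^ rdes r n p * q ^ rmaj r n p *
      (q_num q (Suc (card (stable_slots r n p)))
        + t * (q_num q (Suc n) - q_num q (Suc (card (stable_slots r n p))))))"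
proof -
  have "rdes_rmaj_sum r q (Suc n) t =
     (\<Sum>(p, j)\<in>{p. p permutes {1..n}} \<times> {..n}.
        t ^ rdes r (Suc n) (insert_max n j p) * q ^ rmaj r (Suc n) (insert_max n j p))"
    unfolding rdes_rmaj_sum_def sum.reindex_bij_betw[OF bij_betw_insert_max, symmetric]
    by (simp add: case_prod_unfold)
  also have "\<dots> = (\<Sum>p | p permutes {1..n}. \<Sum>j\<le>n.
        t ^ rdes r (Suc n) (insert_max n j p) * q ^ rmaj r (Suc n) (insert_max n j p))"
    by (rule sum.cartesian_product[symmetric])
  also have "\<dots> = (\<Sum>p | p permutes {1..n}. t ^ rdes r n p * q ^ rmaj r n p *
      (q_num q (Suc (card (stable_slots r n p)))
        + t * (q_num q (Suc n) - q_num q (Suc (card (stable_slots r n p))))))"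
  proof (rule sum.cong[OF refl])
    fix p assume "p \<in> {p. p permutes {1..n}}"
    then have p: "p permutes {1..n}" by simp
    define S where "S = stable_slots r n p"
    have S: "S \<subseteq> {..<n}" by (auto simp: S_def stable_slots_def)
    then have Sn: "n \<notin> S" "{k \<in> S. n \<le> k} = {}" by auto
    have st: "t ^ rdes r (Suc n) (insert_max n j p) * q ^ rmaj r (Suc n) (insert_max n j p) =
        t ^ rdes r n p * q ^ rmaj r n p *
        (if j \<in> S \<or> j = n then q ^ card {k \<in> S. j \<le> k} else t * q ^ (card {k \<in> S. j \<le> k} + Suc j))"
      if "j \<le> n" for j
      unfolding insert_max_stats[OF p that r] S_def[symmetric] by (simp add: power_add)
    have "(\<Sum>j\<le>n. t ^ rdes r (Suc n) (insert_max n j p) * q ^ rmaj r (Suc n) (insert_max n j p)) =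
        t ^ rdes r n p * q ^ rmaj r n p * (\<Sum>j\<le>n. if j \<in> S \<or> j = n then q ^ card {k \<in> S. j \<le> k}
          else t * q ^ (card {k \<in> S. j \<le> k} + Suc j))"
      unfolding sum_distrib_left by (rule sum.cong[OF refl]) (rule st, simp)
    \<comment> \<open>The final slot contributes 1, which cancels the \<open>-1\<close> in
      \<open>slot_sum\<close>.\<close>
    also have "(\<Sum>j\<le>n. if j \<in> S \<or> j = n then q ^ card {k \<in> S. j \<le> k}
          else t * q ^ (card {k \<in> S. j \<le> k} + Suc j)) =
        (\<Sum>j<n. if j \<in> S then q ^ card {k \<in> S. j \<le> k}
          else t * q ^ (card {k \<in> S. j \<le> k} + Suc j)) + 1"
      unfolding lessThan_Suc_atMost[symmetric] sum.lessThan_Suc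
      by (rule arg_cong2[where f = "(+)"], rule sum.cong) (auto simp: Sn)
    finally show "(\<Sum>j\<le>n. t ^ rdes r (Suc n) (insert_max n j p) * q ^ rmaj r (Suc n) (insert_max n j p)) =
       t ^ rdes r n p * q ^ rmaj r n p *
      (q_num q (Suc (card (stable_slots r n p)))
        + t * (q_num q (Suc n) - q_num q (Suc (card (stable_slots r n p)))))"
      unfolding slot_sum[OF S] S_def[symmetric] by simp
  qed
  finally show ?thesis .
qed

lemma card_stable_slots:
  assumes p: "p permutes {1..n}"
  shows "card (stable_slots r n p) = rdes r n p + card {v \<in> {1..n}. Suc n < v + r}"
proof -
  have "bij_betw (\<lambda>k. p (Suc k)) {k. k < n} {1..n}"
    using bij_betw_trans[of Suc "{k. k < n}" "{1..n}" p "{1..n}"] permutes_imp_bij[OF p]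
    by (simp add: o_def bij_betw_def image_Suc_lessThan flip: lessThan_def)
  then have "bij_betw (\<lambda>k. p (Suc k)) {k \<in> {k. k < n}. Suc n < p (Suc k) + r} {v \<in> {1..n}. Suc n < v + r}"
    by (rule bij_betw_Collect) simp
  then have "card {k. 0 \<le> k \<and> k < n \<and> Suc n < p (Suc k) + r} = card {v \<in> {1..n}. Suc n < v + r}"
    by (auto dest: bij_betw_same_card)
  then show ?thesis
    using card_stable_slots_ge[OF p, of r 0] by (simp add: rdes_def)
qed

text \<open>While \<open>n < r\<close> every slot is stable, so no descent arises and each insertion
  contributes a q-integer.\<close>

lemma rdes_rmaj_sum_small:
  assumes "r \<ge> 1"
  shows "n \<le> r \<Longrightarrow> rdes_rmaj_sum r q n t = q_fact q n"
proof (induction n)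
  case 0
  have "{p. p permutes ({} :: nat set)} = {id}" by (auto simp: permutes_empty)
  then show ?case by (simp add: rdes_rmaj_sum_def rdes_def rmaj_def rDes_def rInv_def)
next
  case (Suc n)
  have "stable_slots r n p = {..<n}" if p: "p permutes {1..n}" for p
  proof -
    have "Suc n < p (Suc k) + r" if "k < n" for k
      using permutes_range[OF p, of "Suc k"] Suc.prems that by linarith
    then show ?thesis by (auto simp: stable_slots_def)
  qed
  then have "rdes_rmaj_sum r q (Suc n) t = rdes_rmaj_sum r q n t * q_num q (Suc n)"
    unfolding rdes_rmaj_sum_Suc[OF assms] rdes_rmaj_sum_def[of r q n] sum_distrib_right
    by (intro sum.cong) auto
  then show ?case using Suc by (simp add: q_fact_Suc)
qed

text \<open>For \<open>n \<ge> r\<close> there are \<open>r - 1\<close> letters less than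
  \<open>r\<close> below \<open>n + 1\<close>, which gives the q-integer of
  \<open>r + rdes r n p\<close>. Its multiple by \<open>1 - q\<close> contains
  \<open>q ^ rdes r n p\<close>, absorbed by passing from \<open>t\<close> to
  \<open>q * t\<close>.\<close>

lemma rdes_rmaj_sum_rec:
  assumes r: "r \<ge> 1" and n: "r \<le> n"
  shows "(1 - q) * rdes_rmaj_sum r q (Suc n) t =
    (1 - t * q ^ Suc n) * rdes_rmaj_sum r q n t - q ^ r * (1 - t) * rdes_rmaj_sum r q n (q * t)"
proof -
  have "{v \<in> {1..n}. Suc n < v + r} = {Suc n - r<..n}" using n r by auto
  then have c: "Suc (card (stable_slots r n p)) = r + rdes r n p" if "p permutes {1..n}" for p
    using card_stable_slots[OF that, of r] n r by simp
  have "(1 - q) * rdes_rmaj_sum r q (Suc n) t =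
    (\<Sum>p | p permutes {1..n}. (1 - t * q ^ Suc n) * (t ^ rdes r n p * q ^ rmaj r n p)
      - q ^ r * (1 - t) * ((q * t) ^ rdes r n p * q ^ rmaj r n p))"
    unfolding rdes_rmaj_sum_Suc[OF r] sum_distrib_left
  proof (rule sum.cong[OF refl])
    fix p assume "p \<in> {p. p permutes {1..n}}"
    then have p: "p permutes {1..n}" by simp
    have "(1 - q) * (t ^ rdes r n p * q ^ rmaj r n p * (q_num q (r + rdes r n p)
        + t * (q_num q (Suc n) - q_num q (r + rdes r n p)))) =
      t ^ rdes r n p * q ^ rmaj r n p * ((1 - q) * q_num q (r + rdes r n p)
        + t * ((1 - q) * q_num q (Suc n) - (1 - q) * q_num q (r + rdes r n p)))"
      by (simp add: algebra_simps)
    also have "\<dots> = (1 - t * q ^ Suc n) * (t ^ rdes r n p * q ^ rmaj r n p)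
      - q ^ r * (1 - t) * ((q * t) ^ rdes r n p * q ^ rmaj r n p)"
      unfolding one_minus_q_num by (simp add: power_add power_mult_distrib algebra_simps)
    finally show "(1 - q) * (t ^ rdes r n p * q ^ rmaj r n p * (q_num q (Suc (card (stable_slots r n p)))
        + t * (q_num q (Suc n) - q_num q (Suc (card (stable_slots r n p)))))) =
      (1 - t * q ^ Suc n) * (t ^ rdes r n p * q ^ rmaj r n p)
      - q ^ r * (1 - t) * ((q * t) ^ rdes r n p * q ^ rmaj r n p)"
      unfolding c[OF p] .
  qed
  then show ?thesis
    by (simp add: rdes_rmaj_sum_def sum_subtractf sum_distrib_left)
qed

subsection \<open>Equidistribution\<close>

lemma word_inv_subword_at:
  assumes "finite A"
  shows "word_inv (subword_at p A) = inv_on p A"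
proof -
  define xs where "xs = sorted_list_of_set A"
  have xs: "set xs = A" "sorted_wrt (<) xs"
    using assms by (simp_all add: xs_def)
  define I where "I = {(i, j). i < j \<and> j < length xs \<and> p (xs ! i) > p (xs ! j)}"
  have less: "xs ! i < xs ! j \<longleftrightarrow> i < j" if "i < length xs" "j < length xs" for i j
    using that xs(2) sorted_wrt_nth_less[OF xs(2), of i j] sorted_wrt_nth_less[OF xs(2), of j i]
    by (cases i j rule: linorder_cases) auto
  have "inj_on (map_prod ((!) xs) ((!) xs)) I"
    using xs(2) by (auto simp: inj_on_def I_def nth_eq_iff_index_eq strict_sorted_iff)
  moreover have "map_prod ((!) xs) ((!) xs) ` I = {(i, j). i \<in> A \<and> j \<in> A \<and> i < j \<and> p j < p i}"
  proof (intro equalityI subsetI)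
    fix x assume "x \<in> map_prod ((!) xs) ((!) xs) ` I"
    then show "x \<in> {(i, j). i \<in> A \<and> j \<in> A \<and> i < j \<and> p j < p i}"
      using less xs(1) by (auto simp: I_def)
  next
    fix x assume "x \<in> {(i, j). i \<in> A \<and> j \<in> A \<and> i < j \<and> p j < p i}"
    then obtain i j where x: "x = (xs ! i, xs ! j)" "i < length xs" "j < length xs"
      "xs ! i < xs ! j" "p (xs ! j) < p (xs ! i)"
      unfolding xs(1)[symmetric] by (auto simp: in_set_conv_nth)
    then have "(i, j) \<in> I" using less by (auto simp: I_def)
    then show "x \<in> map_prod ((!) xs) ((!) xs) ` I" using x by force
  qed
  ultimately have "card I = inv_on p A"
    unfolding inv_on_def by (metis card_image)
  moreover have "{(i, j). i < j \<and> j < length (map p xs) \<and> map p xs ! i > map p xs ! j} = I"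
    by (auto simp: I_def)
  ultimately show ?thesis
    by (simp add: word_inv_def subword_at_def xs_def)
qed

text \<open>\<open>max i l + g \<le> p i\<close> says that \<open>p i\<close> is at least
  \<open>i + g\<close> and \<open>g + l\<close>: the threshold encodes the excedance places. As no
  place is open at first, every split of the values gives all permutations.\<close>

lemma gexc_gden_sum:
  fixes q t :: real
  assumes g: "g \<ge> 1" and AV: "A \<union> V = {1..n}"
  shows "(\<Sum>p | p permutes {1..n}. t ^ gexc g l n p * q ^ gden g (g + l) n p) =
    filling_sum q (\<lambda>i. q ^ (i + g - 1) * (if l \<le> i then t else 1)) (\<lambda>i. max i l + g) {} {1..n} A V"
  unfolding filling_sum_def
proof (rule sum.cong)
  show "{p. p permutes {1..n}} = fillings {} {1..n} A V"
    by (simp add: fillings_def AV bijs_permutes)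
  fix p assume "p \<in> fillings {} {1..n} A V"
  then have p: "p permutes {1..n}" by (simp add: fillings_def AV bijs_permutes)
  define E where "E = {i \<in> {1..n}. max i l + g \<le> p i}"
  have fin: "finite E" by (simp add: E_def)
  \<comment> \<open>\<open>gExcp\<close> leaves out place \<open>n\<close>; by
    \<open>g \<ge> 1\<close> so does \<open>E\<close>.\<close>
  have "i < n" if "i \<in> {1..n}" "i + g \<le> p i" for i
    using permutes_range[OF p, of i] that g by auto
  then have E: "gExcp g (g + l) n p = E"
    by (force simp: gExcp_def E_def)
  have N: "gNexcp g (g + l) n p = {i \<in> {1..n}. p i < max i l + g}"
    by (auto simp: gNexcp_def E E_def)
  have c: "{i \<in> {1..n}. p i \<ge> i + g \<and> i \<ge> l} = E \<inter> {i. l \<le> i}"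
    by (auto simp: E_def)
  have "(\<Prod>i\<in>E. if l \<le> i then t else 1) = t ^ gexc g l n p"
    unfolding gexc_def c using fin by (simp add: prod.If_cases)
  moreover have "(\<Prod>i\<in>E. q ^ (i + g - 1)) = q ^ (\<Sum>i\<in>E. i + g - 1)"
    by (simp add: power_sum)
  ultimately show "t ^ gexc g l n p * q ^ gden g (g + l) n p =
      exc_weight q (\<lambda>i. q ^ (i + g - 1) * (if l \<le> i then t else 1)) (\<lambda>i. max i l + g) {} {1..n} p"
    unfolding exc_weight_def E_def[symmetric] prod.distrib
    using fin by (simp add: gden_def gExc_def gNexc_def word_inv_subword_at E N power_add)
qed

text \<open>For \<open>n < r\<close> no threshold is reached and both sides are a q-factorial.
  Otherwise the scan gives a path sum, identified through the recursion that both families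
  share.\<close>

lemma gexc_gden_sum_eq:
  fixes q t :: real
  assumes gl: "g \<ge> 1" "l \<ge> 1" and q: "q > 0" "q \<noteq> 1"
  shows "(\<Sum>p | p permutes {1..n}. t ^ gexc g l n p * q ^ gden g (g + l) n p) =
    rdes_rmaj_sum (g + l - 1) q n t"
proof -
  define r where "r = g + l - 1"
  define w where "w i = q ^ (i + g - 1) * (if l \<le> i then t else 1)" for i
  have r: "r \<ge> 1" "r = g + (l - 1)" using gl by (auto simp: r_def)
  show ?thesis
  proof (cases "r \<le> n")
    case False
    have "filling_sum q w (\<lambda>i. max i l + g) {} {1..n} {1..n} {} = q_fact q (card {1..n})"
    proof (rule filling_sum_no_exc)
      show "x < max i l + g" if "x \<in> {1..n}" for x i
      proof -
        have "x \<le> n" "l \<le> max i l" using that by auto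
        then show ?thesis using False gl by (simp add: r_def)
      qed
      show "max i l + g \<le> max j l + g" if "i \<le> j" for i j using that by (simp add: max.coboundedI1)
    qed simp_all
    moreover have "(\<Sum>p | p permutes {1..n}. t ^ gexc g l n p * q ^ gden g (g + l) n p) =
        filling_sum q w (\<lambda>i. max i l + g) {} {1..n} {1..n} {}"
      unfolding w_def by (rule gexc_gden_sum[OF gl(1)]) simp
    moreover have "rdes_rmaj_sum r q n t = q_fact q n"
      using False r(1) by (simp add: rdes_rmaj_sum_small)
    ultimately show ?thesis by (simp only: r_def card_atLeastAtMost diff_Suc_1)
  next
    case True
    have "{1..r} \<union> {r<..n} = {1..n}" using True by auto
    then have "(\<Sum>p | p permutes {1..n}. t ^ gexc g l n p * q ^ gden g (g + l) n p) =
        filling_sum q w (\<lambda>i. max i l + g) {} {1..n} {1..r} {r<..n}"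
      unfolding w_def by (rule gexc_gden_sum[OF gl(1)])
    also have "\<dots> = q_path q r (\<lambda>s. w (n - g - s)) (n - r) 0"
      using r True gl by (intro filling_sum_all[where l = l and m = "l - 1"]) (auto simp: w_def)
    also have "\<dots> = rdes_rmaj_sum r q n t"
    proof -
      \<comment> \<open>The recursion starts at \<open>n = r\<close> with the constant
        \<open>q_fact q r\<close>, which is also the weight of the empty path; so it
        cancels.\<close>
      have "q_fact q r * q_path q r (\<lambda>s. w (n - g - s)) (n - r) 0 =
          q_fact q r * rdes_rmaj_sum r q (r + (n - r)) t"
      proof (rule q_path_eq_of_recursion[OF q, where f = "\<lambda>N. rdes_rmaj_sum r q (r + N)"])
        show "rdes_rmaj_sum r q (r + 0) t = q_fact q r" for t
          using rdes_rmaj_sum_small[OF r(1)] by simp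
        show "(1 - q) * rdes_rmaj_sum r q (r + Suc N) t =
           (1 - t * q ^ (N + r + 1)) * rdes_rmaj_sum r q (r + N) t
           - q ^ r * (1 - t) * rdes_rmaj_sum r q (r + N) (q * t)" for N t
          using rdes_rmaj_sum_rec[OF r(1), of "r + N" q t] by (simp add: add.commute)
        \<comment> \<open>After \<open>j\<close> double steps the next place is
          \<open>l + j\<close>, which carries a factor \<open>t\<close>.\<close>
        fix j assume j: "j < n - r"
        then have "n - g - (n - r - Suc j) = l + j" "l + j + g - 1 = r + j"
          using r True gl by auto
        then show "w (n - g - (n - r - Suc j)) = t * q ^ (r + j)"
          by (simp add: w_def)
      qed
      then show ?thesis using q_fact_pos[OF q(1), of r] True by simp
    qed
    finally show ?thesis by (simp add: r_def)
  qed
qed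

text \<open>A nonzero polynomial has finitely many roots: used in the inner variable for fixed
  \<open>m\<close>, then in the outer one over constants. The bound 2 avoids \<open>q = 1\<close>
  and \<open>q \<le> 0\<close>.\<close>

lemma bivariate_poly_eqI:
  fixes P Q :: "int poly poly"
  assumes "\<And>m k. k \<ge> 2 \<Longrightarrow> poly (poly P [:m:]) k = poly (poly Q [:m:]) k"
  shows "P = Q"
proof -
  have "poly (P - Q) [:m:] = 0" for m
  proof (rule ccontr)
    assume "poly (P - Q) [:m:] \<noteq> 0"
    then have "finite {k. poly (poly (P - Q) [:m:]) k = 0}" by (rule poly_roots_finite)
    moreover have "{2..} \<subseteq> {k. poly (poly (P - Q) [:m:]) k = 0}"
      using assms by auto
    ultimately show False using infinite_Ici finite_subset by blast
  qed
  then have "range (\<lambda>m. [:m:]) \<subseteq> {x. poly (P - Q) x = 0}" by auto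
  moreover have "infinite (range (\<lambda>m :: int. [:m:]))"
    by (auto simp: finite_image_iff inj_def infinite_UNIV_int)
  ultimately have "P - Q = 0"
    using poly_roots_finite[of "P - Q"] finite_subset by blast
  then show ?thesis by simp
qed

theorem theorem1p3:
  fixes g l :: nat
  assumes "g \<ge> 1" and "l \<ge> 1"
  shows "r_Euler_Mahonian (g + l - 1) (gexc g l) (gden g (g + l))"
  unfolding r_Euler_Mahonian_def
proof (intro allI impI bivariate_poly_eqI)
  fix n :: nat and m k :: int
  assume "k \<ge> 2"
  have eval: "poly (poly (\<Sum>p | p permutes {1..n}. var_t ^ a p * var_q ^ b p) [:m:]) k =
      (\<Sum>p | p permutes {1..n}. m ^ a p * k ^ b p)" for a b :: "(nat \<Rightarrow> nat) \<Rightarrow> nat"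
    by (simp add: poly_sum var_t_def var_q_def)
  \<comment> \<open>The integer values are compared as reals, where the identity was proved.\<close>
  have "real_of_int (\<Sum>p | p permutes {1..n}. m ^ gexc g l n p * k ^ gden g (g + l) n p) =
      real_of_int (\<Sum>p | p permutes {1..n}. m ^ rdes (g + l - 1) n p * k ^ rmaj (g + l - 1) n p)"
    using gexc_gden_sum_eq[OF assms, of "real_of_int k" "real_of_int m" n] \<open>k \<ge> 2\<close>
    by (simp add: rdes_rmaj_sum_def)
  then show "poly (poly (\<Sum>p | p permutes {1..n}. var_t ^ gexc g l n p * var_q ^ gden g (g + l) n p) [:m:]) k =
      poly (poly (\<Sum>p | p permutes {1..n}. var_t ^ rdes (g + l - 1) n p * var_q ^ rmaj (g + l - 1) n p) [:m:]) k"
    unfolding eval of_int_eq_iff .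
qed

end
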